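(* Let $p$ be a prime. If $G$ is a finite $p$-group such that $\mathrm{cod}(G)=\{1,p,p^{a-1},p^a\}$ for some $a\ge 4$, then the nilpotence class of $G$ is at most $a$.
   Context: For an irreducible complex character $\chi$ of a finite group $G$, the codegree of $\chi$ is $\mathrm{cod}(\chi)=|G:\ker\chi|/\chi(1)$, and $\mathrm{cod}(G)$ denotes the set of codegrees of the irreducible characters of $G$. *)

theory Defs
  imports "HOL-Algebra.Algebra" "Jordan_Normal_Form.Matrix"
begin

definition is_rep :: "('a, 'b) monoid_scheme \<Rightarrow> nat \<Rightarrow> ('a \<Rightarrow> complex mat) \<Rightarrow> bool" where
  "is_rep G n \<rho> \<longleftrightarrow>
     (\<forall>g \<in> carrier G. \<rho> g \<in> carrier_mat n n) \<and>
     \<rho> \<one>\<^bsub>G\<^esub> = 1\<^sub>m n \<and>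
     (\<forall>g \<in> carrier G. \<forall>h \<in> carrier G. \<rho> (g \<otimes>\<^bsub>G\<^esub> h) = \<rho> g * \<rho> h)"

definition invariant_subspace :: "('a, 'b) monoid_scheme \<Rightarrow> nat \<Rightarrow> ('a \<Rightarrow> complex mat) \<Rightarrow> complex vec set \<Rightarrow> bool" where
  "invariant_subspace G n \<rho> W \<longleftrightarrow>
     W \<subseteq> carrier_vec n \<and> 0\<^sub>v n \<in> W \<and>
     (\<forall>v \<in> W. \<forall>w \<in> W. v + w \<in> W) \<and>
     (\<forall>c::complex. \<forall>v \<in> W. c \<cdot>\<^sub>v v \<in> W) \<and>
     (\<forall>g \<in> carrier G. \<forall>v \<in> W. \<rho> g *\<^sub>v v \<in> W)"

definition irr_rep :: "('a, 'b) monoid_scheme \<Rightarrow> nat \<Rightarrow> ('a \<Rightarrow> complex mat) \<Rightarrow> bool" where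
  "irr_rep G n \<rho> \<longleftrightarrow> is_rep G n \<rho> \<and> n > 0 \<and>
     (\<forall>W. invariant_subspace G n \<rho> W \<longrightarrow> W = {0\<^sub>v n} \<or> W = carrier_vec n)"

definition mat_trace :: "complex mat \<Rightarrow> complex" where
  "mat_trace A = (\<Sum>i<dim_row A. A $$ (i, i))"

definition Irr :: "('a, 'b) monoid_scheme \<Rightarrow> ('a \<Rightarrow> complex) set" where
  "Irr G = {\<chi>. \<exists>n \<rho>. irr_rep G n \<rho> \<and>
              \<chi> = (\<lambda>g. if g \<in> carrier G then mat_trace (\<rho> g) else 0)}"

definition char_ker :: "('a, 'b) monoid_scheme \<Rightarrow> ('a \<Rightarrow> complex) \<Rightarrow> 'a set" where
  "char_ker G \<chi> = {g \<in> carrier G. \<chi> g = \<chi> \<one>\<^bsub>G\<^esub>}"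

definition codegree :: "('a, 'b) monoid_scheme \<Rightarrow> ('a \<Rightarrow> complex) \<Rightarrow> complex" where
  "codegree G \<chi> = (of_nat (card (carrier G)) / of_nat (card (char_ker G \<chi>))) / \<chi> \<one>\<^bsub>G\<^esub>"

definition cod :: "('a, 'b) monoid_scheme \<Rightarrow> complex set" where
  "cod G = codegree G ` Irr G"

text \<open>Lower central series: index 0 is G = gamma_1, index (Suc i) is [gamma_(i+1), G].\<close>
fun lower_central :: "('a, 'b) monoid_scheme \<Rightarrow> nat \<Rightarrow> 'a set" where
  "lower_central G 0 = carrier G"
| "lower_central G (Suc i) = generate G
     {x \<otimes>\<^bsub>G\<^esub> y \<otimes>\<^bsub>G\<^esub> inv\<^bsub>G\<^esub> x \<otimes>\<^bsub>G\<^esub> inv\<^bsub>G\<^esub> y | x y. x \<in> lower_central G i \<and> y \<in> carrier G}"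

definition nilpotency_class :: "('a, 'b) monoid_scheme \<Rightarrow> nat" where
  "nilpotency_class G = (LEAST c. lower_central G c = {\<one>\<^bsub>G\<^esub>})"

end

(* If gamma_{a+1}(G) were nontrivial, an irreducible representation nontrivial on a central element of
   it has a kernel K such that Q = G/K satisfies |Q| <= p^(2a-1): the degree n satisfies
   n^2 |Z(chi) : K| <= |Q| and |Q| = n p^b with b <= a. As p^2 is not a codegree, Q/Q' has exponent p,
   hence so has every lower central factor. An irreducible representation psi of Q that is trivial
   on gamma_3 but not on Q' is fully ramified over its center, which is cyclic of order p or p^2 modulo
   the kernel, so its codegree forces |Q : Q'| to be large. As |Q'| >= p^a, this contradicts
   |Q| <= p^(2a-1) unless a = 4 and every inequality is tight. In that case an element u generating
   the center of psi has u^p generating Q' modulo gamma_3, while [u^p, g] = [u, g]^p lies in gamma_4 for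
   all g, so gamma_3 = gamma_4. *)
theory Submission
  imports Defs "Jordan_Normal_Form.Spectral_Radius" "Jordan_Normal_Form.Schur_Decomposition"
begin

hide_const (open) Polynomial.order
hide_fact (open) Polynomial.order_def

section \<open>Complex matrices\<close>

text \<open>Codegrees refer to the set where chi(g) = chi(1), so this set must be recognized as the
  kernel of a matrix representation. A matrix of finite order is triangularized; its diagonal
  consists of roots of unity, and trace n forces them all to be 1. Of the orthogonality relations
  only the sum of |chi(g)|^2 = |G| enters: restricted to Z(chi) it gives n^2 |Z(chi)| <= |G|, with
  equality if chi vanishes elsewhere. Complete reducibility is bypassed: an irreducible
  representation nontrivial on a central z is one of least dimension among those in which z fixes no
  nonzero vector. The bound a >= 4 separates the exponent 2 from a - 1. It is also where the count
  becomes tight: write p^b for the codegree of psi and p^s for the index of its kernel in its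
  center. Then psi(1) = p^(b-s), the kernel has order at least p^(a-1), and |Q| <= p^(2a-1) becomes
  2b - s <= a. With b >= a - 1 and s <= 2 this leaves only a = 4, b = 3, s = 2.\<close>

lemma mat_trace_mult_comm:
  assumes "A \<in> carrier_mat n m" "B \<in> carrier_mat m n"
  shows "mat_trace (A * B) = mat_trace (B * A)"
proof -
  have "mat_trace (A * B) = (\<Sum>i<n. \<Sum>j<m. A $$ (i,j) * B $$ (j,i))"
    using assms by (auto simp: mat_trace_def scalar_prod_def lessThan_atLeast0 intro!: sum.cong)
  also have "\<dots> = (\<Sum>j<m. \<Sum>i<n. B $$ (j,i) * A $$ (i,j))"
    by (subst sum.swap) (simp add: mult.commute)
  also have "\<dots> = mat_trace (B * A)"
    using assms by (auto simp: mat_trace_def scalar_prod_def lessThan_atLeast0 intro!: sum.cong)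
  finally show ?thesis .
qed

lemma mat_trace_one [simp]: "mat_trace (1\<^sub>m n) = of_nat n"
  by (simp add: mat_trace_def)

lemma mat_trace_smult_one [simp]: "mat_trace (c \<cdot>\<^sub>m 1\<^sub>m n) = of_nat n * c"
  by (simp add: mat_trace_def)

lemma mat_trace_similar:
  assumes A: "A \<in> carrier_mat n n" and sim: "similar_mat_wit A B P Q"
  shows "mat_trace A = mat_trace B"
proof -
  note s = similar_mat_witD2[OF A sim]
  have "mat_trace A = mat_trace (P * (B * Q))" using s by (simp add: assoc_mult_mat[of _ n n _ n _ n])
  also have "\<dots> = mat_trace ((B * Q) * P)" using s by (intro mat_trace_mult_comm) auto
  also have "(B * Q) * P = B" using s by (simp add: assoc_mult_mat[of _ n n _ n _ n])
  finally show ?thesis .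
qed

text \<open>If s < r, padding both factors with zeros to r by r matrices keeps their product equal
  to 1, so the padded factors are inverse in the other order too. But column s of the padded A is
  zero.\<close>

lemma right_inverse_dim_le:
  fixes A B :: "'a :: field mat"
  assumes A: "A \<in> carrier_mat r s" and B: "B \<in> carrier_mat s r" and AB: "A * B = 1\<^sub>m r"
  shows "r \<le> s"
proof (rule ccontr)
  assume "\<not> r \<le> s"
  hence sr: "s < r" by simp
  define A' where "A' = mat r r (\<lambda>(i,j). if j < s then A $$ (i,j) else 0)"
  define B' where "B' = mat r r (\<lambda>(i,j). if i < s then B $$ (i,j) else 0)"
  have A': "A' \<in> carrier_mat r r" and B': "B' \<in> carrier_mat r r" by (auto simp: A'_def B'_def)
  have "A' * B' = 1\<^sub>m r"
  proof (rule eq_matI)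
    fix i j assume "i < dim_row (1\<^sub>m r :: 'a mat)" "j < dim_col (1\<^sub>m r :: 'a mat)"
    hence ij: "i < r" "j < r" by auto
    have "(A' * B') $$ (i,j) = (\<Sum>k\<in>{0..<r}. if k < s then A $$ (i,k) * B $$ (k,j) else 0)"
      using ij by (auto simp: A'_def B'_def scalar_prod_def intro!: sum.cong)
    also have "\<dots> = (\<Sum>k\<in>{0..<s}. A $$ (i,k) * B $$ (k,j))"
      using sr by (intro sum.mono_neutral_cong_right) auto
    also have "\<dots> = (A * B) $$ (i,j)"
      using A B ij by (auto simp: scalar_prod_def intro!: sum.cong)
    finally show "(A' * B') $$ (i,j) = 1\<^sub>m r $$ (i,j)" unfolding AB .
  qed (use A' B' in auto)
  moreover have "A' *\<^sub>v unit_vec r s = 0\<^sub>v r"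
    using sr by (intro eq_vecI) (auto simp: A'_def)
  moreover have "B' *\<^sub>v 0\<^sub>v r = 0\<^sub>v r"
    using B' by (intro eq_vecI) auto
  ultimately have "1\<^sub>m r *\<^sub>v unit_vec r s = (0\<^sub>v r :: 'a vec)"
    using mat_mult_left_right_inverse[OF A' B']
      assoc_mult_mat_vec[OF B' A', of "unit_vec r s"] by simp
  hence "unit_vec r s = (0\<^sub>v r :: 'a vec)" by simp
  thus False using sr by (metis index_unit_vec(2) index_zero_vec(1) zero_neq_one)
qed

text \<open>The columns of B form a basis of W and C reads off coordinates; B * C is a projection
  onto W. A largest d for which B and C exist works, since a vector of W moved by B * C would allow
  one more column.\<close>

lemma subspace_coordinates:
  fixes W :: "'a :: field vec set"
  assumes sub: "W \<subseteq> carrier_vec n" and zero: "0\<^sub>v n \<in> W"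
    and add: "\<And>v w. v \<in> W \<Longrightarrow> w \<in> W \<Longrightarrow> v + w \<in> W"
    and smult: "\<And>c v. v \<in> W \<Longrightarrow> c \<cdot>\<^sub>v v \<in> W"
  obtains d B C where "B \<in> carrier_mat n d" "C \<in> carrier_mat d n" "C * B = 1\<^sub>m d"
    "\<And>x. x \<in> carrier_vec d \<Longrightarrow> B *\<^sub>v x \<in> W" "\<And>w. w \<in> W \<Longrightarrow> B *\<^sub>v (C *\<^sub>v w) = w"
proof -
  define P where "P d \<longleftrightarrow> (\<exists>B C. B \<in> carrier_mat n d \<and> C \<in> carrier_mat d n \<and> C * B = 1\<^sub>m d \<and>
    (\<forall>x\<in>carrier_vec d. B *\<^sub>v x \<in> W))" for d
  have "B *\<^sub>v x = 0\<^sub>v n" if "B \<in> carrier_mat n 0" "x \<in> carrier_vec 0" for B :: "'a mat" and x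
    using that by (intro eq_vecI) (auto simp: scalar_prod_def)
  hence P0: "P 0"
    unfolding P_def using zero
    by (intro exI[of _ "0\<^sub>m n 0"] exI[of _ "0\<^sub>m 0 n"]) (auto intro!: eq_matI)
  have bound: "d \<le> n" if "P d" for d
    using that right_inverse_dim_le unfolding P_def by blast
  define d where "d = Greatest P"
  have Pd: "P d" unfolding d_def using P0 bound by (rule GreatestI_nat)
  have max: "\<not> P (Suc d)"
    using Greatest_le_nat[of P "Suc d" n] bound unfolding d_def by fastforce
  from Pd obtain B C where B: "B \<in> carrier_mat n d" and C: "C \<in> carrier_mat d n"
    and CB: "C * B = 1\<^sub>m d" and BW: "\<And>x. x \<in> carrier_vec d \<Longrightarrow> B *\<^sub>v x \<in> W"
    unfolding P_def by blast
  have "B *\<^sub>v (C *\<^sub>v w) = w" if w: "w \<in> W" for w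
  proof (rule ccontr)
    assume ne: "B *\<^sub>v (C *\<^sub>v w) \<noteq> w"
    have wc: "w \<in> carrier_vec n" using w sub by auto
    \<comment> \<open>The part of w that the projection B * C misses: a nonzero vector of W that C
      kills.\<close>
    define v where "v = w + (- 1) \<cdot>\<^sub>v (B *\<^sub>v (C *\<^sub>v w))"
    have BCw: "B *\<^sub>v (C *\<^sub>v w) \<in> W" using BW C wc by simp
    have vW: "v \<in> W" unfolding v_def using w BCw by (intro add smult)
    hence vc: "v \<in> carrier_vec n" using sub by auto
    have BCwc: "B *\<^sub>v (C *\<^sub>v w) \<in> carrier_vec n" using BCw sub by auto
    obtain k where k: "k < n" "v $ k \<noteq> 0"
    proof (rule ccontr)
      assume "\<not> thesis"
      hence "\<And>k. k < n \<Longrightarrow> v $ k = 0" using that by blast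
      hence "w = B *\<^sub>v (C *\<^sub>v w)" using wc BCwc B by (intro eq_vecI) (auto simp: v_def)
      thus False using ne by simp
    qed
    have Cv: "C *\<^sub>v v = 0\<^sub>v d"
    proof -
      have "C *\<^sub>v (B *\<^sub>v (C *\<^sub>v w)) = C *\<^sub>v w"
        using assoc_mult_mat_vec[OF C B, of "C *\<^sub>v w"] C wc by (simp add: CB)
      moreover have "C *\<^sub>v v = C *\<^sub>v w + (- 1) \<cdot>\<^sub>v (C *\<^sub>v (B *\<^sub>v (C *\<^sub>v w)))"
        unfolding v_def using C wc BCwc
        by (simp add: mult_add_distrib_mat_vec[OF C] mult_mat_vec[OF C])
      ultimately show ?thesis using C wc by (intro eq_vecI) auto
    qed
    \<comment> \<open>E is the complementary projection: it kills the columns of B and fixes v. Its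
      row k, divided by v $ k, is therefore the extra row that a left inverse of B extended by v
      requires.\<close>
    define E where "E = 1\<^sub>m n - B * C"
    have E: "E \<in> carrier_mat n n" using B C by (auto simp: E_def)
    have EB: "E * B = 0\<^sub>m n d"
    proof -
      have "E * B = 1\<^sub>m n * B - (B * C) * B"
        unfolding E_def using B C by (intro minus_mult_distrib_mat) auto
      also have "(B * C) * B = B" using assoc_mult_mat[OF B C B] B by (simp add: CB)
      finally show ?thesis using B by simp
    qed
    have Ev: "E *\<^sub>v v = v"
    proof -
      have "E *\<^sub>v v = 1\<^sub>m n *\<^sub>v v - (B * C) *\<^sub>v v"
        unfolding E_def using B C vc by (intro minus_mult_distrib_mat_vec) auto
      also have "(B * C) *\<^sub>v v = B *\<^sub>v (C *\<^sub>v v)" using assoc_mult_mat_vec[OF B C vc] .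
      also have "\<dots> = 0\<^sub>v n" unfolding Cv using B by (intro eq_vecI) auto
      finally show ?thesis using vc by simp
    qed
    define B' where "B' = mat n (Suc d) (\<lambda>(i,j). if j < d then B $$ (i,j) else v $ i)"
    define C' where "C' = mat (Suc d) n (\<lambda>(i,j). if i < d then C $$ (i,j) else E $$ (k,j) / v $ k)"
    have B': "B' \<in> carrier_mat n (Suc d)" and C': "C' \<in> carrier_mat (Suc d) n"
      by (auto simp: B'_def C'_def)
    have s1: "(\<Sum>l\<in>{0..<n}. C $$ (i,l) * B $$ (l,j)) = (if i = j then 1 else 0)"
      if "i < d" "j < d" for i j
      using arg_cong[OF CB, of "\<lambda>M. M $$ (i,j)"] B C that by (simp add: scalar_prod_def)
    have s2: "(\<Sum>l\<in>{0..<n}. C $$ (i,l) * v $ l) = 0" if "i < d" for i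
      using arg_cong[OF Cv, of "\<lambda>x. x $ i"] C vc that by (simp add: scalar_prod_def)
    have s3: "(\<Sum>l\<in>{0..<n}. E $$ (k,l) * B $$ (l,j)) = 0" if "j < d" for j
      using arg_cong[OF EB, of "\<lambda>M. M $$ (k,j)"] E B k that by (simp add: scalar_prod_def)
    have s4: "(\<Sum>l\<in>{0..<n}. E $$ (k,l) * v $ l) = v $ k"
      using arg_cong[OF Ev, of "\<lambda>x. x $ k"] E vc k by (simp add: scalar_prod_def)
    have "C' * B' = 1\<^sub>m (Suc d)"
    proof (rule eq_matI)
      fix i j assume "i < dim_row (1\<^sub>m (Suc d) :: 'a mat)" "j < dim_col (1\<^sub>m (Suc d) :: 'a mat)"
      hence ij: "i < Suc d" "j < Suc d" by auto
      have "(C' * B') $$ (i,j) = (\<Sum>l\<in>{0..<n}. (if i < d then C $$ (i,l) else E $$ (k,l) / v $ k)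
              * (if j < d then B $$ (l,j) else v $ l))"
        using ij by (auto simp: B'_def C'_def scalar_prod_def)
      also have "\<dots> = (if i = j then 1 else 0)"
        using ij s1 s2 s3 s4 k
        by (cases "i < d"; cases "j < d")
          (simp_all add: sum_divide_distrib[symmetric])
      finally show "(C' * B') $$ (i,j) = 1\<^sub>m (Suc d) $$ (i,j)" using ij by simp
    qed (use B' C' in auto)
    moreover have "B' *\<^sub>v x \<in> W" if x: "x \<in> carrier_vec (Suc d)" for x
    proof -
      have "B' *\<^sub>v x = B *\<^sub>v vec d (\<lambda>i. x $ i) + x $ d \<cdot>\<^sub>v v"
        using B vc x by (intro eq_vecI) (auto simp: B'_def scalar_prod_def mult.commute)
      thus ?thesis using BW vW by (auto intro!: add smult)
    qed
    ultimately show False using max B' C' unfolding P_def by blast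
  qed
  with that B C CB BW show thesis by blast
qed

section \<open>Triangular matrices and matrices of finite order\<close>

lemma upper_triangular_mult:
  assumes "A \<in> carrier_mat n n" "B \<in> carrier_mat n n" "upper_triangular A" "upper_triangular B"
  shows "upper_triangular (A * B)" "i < n \<Longrightarrow> (A * B) $$ (i,i) = A $$ (i,i) * B $$ (i,i)"
proof -
  have z: "A $$ (i,k) * B $$ (k,j) = 0" if "i < n" "k < n" "j < n" "k < i \<or> j < k" for i j k
    using that assms by (auto dest: upper_triangularD)
  show "upper_triangular (A * B)"
  proof (rule upper_triangularI)
    fix i j assume "j < i" "i < dim_row (A * B)"
    hence ij: "j < i" "i < n" "j < n" using assms(1) by auto
    have "(A * B) $$ (i,j) = (\<Sum>k\<in>{0..<n}. A $$ (i,k) * B $$ (k,j))"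
      using assms(1,2) ij by (simp add: scalar_prod_def)
    also have "\<dots> = 0"
    proof (intro sum.neutral ballI)
      fix k assume "k \<in> {0..<n}"
      thus "A $$ (i,k) * B $$ (k,j) = 0" using z[of i k j] ij by (cases "k < i") auto
    qed
    finally show "(A * B) $$ (i,j) = 0" .
  qed
  assume i: "i < n"
  have "(A * B) $$ (i,i) = (\<Sum>k\<in>{0..<n}. A $$ (i,k) * B $$ (k,i))"
    using assms(1,2) i by (simp add: scalar_prod_def)
  also have "\<dots> = (\<Sum>k\<in>{0..<n}. if k = i then A $$ (i,i) * B $$ (i,i) else 0)"
  proof (intro sum.cong refl)
    fix k assume "k \<in> {0..<n}"
    thus "A $$ (i,k) * B $$ (k,i) = (if k = i then A $$ (i,i) * B $$ (i,i) else 0)"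
      using z[of i k i] i by (cases k i rule: linorder_cases) auto
  qed
  finally have "(A * B) $$ (i,i) = \<dots>" .
  thus "(A * B) $$ (i,i) = A $$ (i,i) * B $$ (i,i)" using i by simp
qed

lemma upper_triangular_pow:
  assumes A: "A \<in> carrier_mat n n" and ut: "upper_triangular A"
  shows "upper_triangular (A ^\<^sub>m k)" "i < n \<Longrightarrow> (A ^\<^sub>m k) $$ (i,i) = (A $$ (i,i)) ^ k"
proof -
  have "upper_triangular (A ^\<^sub>m k) \<and> (i < n \<longrightarrow> (A ^\<^sub>m k) $$ (i,i) = (A $$ (i,i)) ^ k)"
  proof (induction k)
    case 0 show ?case using A by simp
  next
    case (Suc k)
    note t = upper_triangular_mult[OF pow_carrier_mat[OF A] A conjunct1[OF Suc] ut]
    show ?case using t(1) t(2)[of i] Suc by (simp add: power_commutes)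
  qed
  thus "upper_triangular (A ^\<^sub>m k)" "i < n \<Longrightarrow> (A ^\<^sub>m k) $$ (i,i) = (A $$ (i,i)) ^ k"
    by blast+
qed

text \<open>Above the diagonal, a power of a unipotent upper triangular matrix is additive in the exponent
  on the first nonvanishing superdiagonal, so it can only be the identity if the matrix is.\<close>

lemma unipotent_finite_order:
  fixes A :: "'a :: field_char_0 mat"
  assumes A: "A \<in> carrier_mat n n" and ut: "upper_triangular A"
    and diag: "\<And>i. i < n \<Longrightarrow> A $$ (i,i) = 1" and k: "k > 0" "A ^\<^sub>m k = 1\<^sub>m n"
  shows "A = 1\<^sub>m n"
proof -
  have off: "i < j \<Longrightarrow> j < n \<Longrightarrow> A $$ (i,j) = 0" for i j
  \<comment> \<open>By induction the entries strictly between diagonal and position (i,j) vanish, so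
    in row i times column j only the terms at i and at j survive.\<close>
  proof (induction "j - i" arbitrary: i j rule: less_induct)
    case less
    have pow: "(A ^\<^sub>m m) $$ (i,j) = of_nat m * A $$ (i,j)" for m
    proof (induction m)
      case 0 thus ?case using A less.prems by simp
    next
      case (Suc m)
      have zero: "(A ^\<^sub>m m) $$ (i,l) * A $$ (l,j) = 0" if l: "l < n" "l \<noteq> i" "l \<noteq> j" for l
      proof -
        consider "l < i" | "i < l" "l < j" | "j < l"
          using l by linarith
        thus ?thesis
        proof cases
          case 1 thus ?thesis
            using upper_triangularD[OF upper_triangular_pow(1)[OF A ut], of l i m] A less.prems by simp
        next
          case 2 thus ?thesis using less.hyps[of j l] less.prems by simp
        next
          case 3 thus ?thesis using upper_triangularD[OF ut, of j l] A l by simp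
        qed
      qed
      have "(A ^\<^sub>m Suc m) $$ (i,j) = (\<Sum>l\<in>{0..<n}. (A ^\<^sub>m m) $$ (i,l) * A $$ (l,j))"
        using A less.prems by (simp add: scalar_prod_def)
      also have "\<dots> = (\<Sum>l\<in>{i,j}. (A ^\<^sub>m m) $$ (i,l) * A $$ (l,j))"
        using less.prems zero by (intro sum.mono_neutral_right) auto
      also have "\<dots> = of_nat (Suc m) * A $$ (i,j)"
        using less.prems Suc diag upper_triangular_pow(2)[OF A ut, of i m] by (simp add: algebra_simps)
      finally show ?case .
    qed
    have "of_nat k * A $$ (i,j) = 0" using pow[of k] k less.prems by simp
    thus ?case using k by simp
  qed
  show ?thesis
  proof (rule eq_matI)
    fix i j assume "i < dim_row (1\<^sub>m n :: 'a mat)" "j < dim_col (1\<^sub>m n :: 'a mat)"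
    thus "A $$ (i,j) = 1\<^sub>m n $$ (i,j)"
      using A diag off upper_triangularD[OF ut] by (cases i j rule: linorder_cases) auto
  qed (use A in auto)
qed

text \<open>Triangular form is enough: the diagonal consists of k-th roots of unity and its power
  sums are the traces of the powers of A. The witnesses P and Q are kept so that B = 1 can be
  carried back to A.\<close>

lemma finite_order_triangular:
  fixes A :: "complex mat"
  assumes A: "A \<in> carrier_mat n n" and k: "A ^\<^sub>m k = 1\<^sub>m n"
  obtains B P Q where "similar_mat_wit A B P Q" "B \<in> carrier_mat n n" "upper_triangular B"
    "B ^\<^sub>m k = 1\<^sub>m n" "\<forall>i<n. (B $$ (i,i)) ^ k = 1"
    "\<forall>m. mat_trace (A ^\<^sub>m m) = (\<Sum>i<n. (B $$ (i,i)) ^ m)"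
proof -
  obtain as where as: "char_poly A = (\<Prod>a\<leftarrow>as. [:- a, 1:])"
    using char_poly_factorized[OF A] by auto
  obtain B where B: "B \<in> carrier_mat n n" "upper_triangular B" "similar_mat A B"
    using schur_decomposition_exists[OF A as] by auto
  then obtain P Q where w: "similar_mat_wit A B P Q" by (auto simp: similar_mat_def)
  note s = similar_mat_witD2[OF A w]
  have wk: "similar_mat_wit (A ^\<^sub>m m) (B ^\<^sub>m m) P Q" for m by (rule similar_mat_wit_pow[OF w])
  have "B ^\<^sub>m k = Q * (A ^\<^sub>m k) * P"
    by (rule similar_mat_witD2(3)[OF pow_carrier_mat[OF B(1)] similar_mat_wit_sym[OF wk[of k]]])
  also have "\<dots> = 1\<^sub>m n" unfolding k using s by simp
  finally have Bk: "B ^\<^sub>m k = 1\<^sub>m n" .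
  have d: "(B $$ (i,i)) ^ k = 1" if "i < n" for i
    using upper_triangular_pow(2)[OF B(1,2) that, of k] Bk that by simp
  have "mat_trace (A ^\<^sub>m m) = (\<Sum>i<n. (B $$ (i,i)) ^ m)" for m
    using mat_trace_similar[OF pow_carrier_mat[OF A] wk[of m]] B upper_triangular_pow(2)[OF B(1,2)]
    by (simp add: mat_trace_def)
  thus thesis using that[OF w B(1,2) Bk] d by blast
qed

text \<open>All real parts are at most 1 and sum to the number of terms, so each is 1; modulus 1
  then leaves no imaginary part.\<close>

lemma sum_unit_complex_eq_card:
  fixes f :: "'a \<Rightarrow> complex"
  assumes "finite I" "\<And>i. i \<in> I \<Longrightarrow> cmod (f i) = 1" "sum f I = of_nat (card I)" "i \<in> I"
  shows "f i = 1"
proof -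
  have le: "Re (f i) \<le> 1" if "i \<in> I" for i using complex_Re_le_cmod[of "f i"] assms(2)[OF that] by simp
  have "(\<Sum>i\<in>I. 1 - Re (f i)) = 0"
    using arg_cong[OF assms(3), of Re] by (simp add: sum_subtractf)
  hence "1 - Re (f i) = 0"
    using assms(1,4) le by (subst (asm) sum_nonneg_eq_0_iff) auto
  moreover have "(Re (f i))\<^sup>2 + (Im (f i))\<^sup>2 = 1"
    using assms(2)[OF assms(4)] cmod_power2[of "f i"] by simp
  ultimately show ?thesis by (auto simp: complex_eq_iff)
qed

text \<open>The diagonal of the triangular form consists of n numbers of modulus 1 with sum n, so
  the form is unipotent, and finite order makes it the identity. This is why the kernel of a
  character is the kernel of its representation.\<close>

lemma finite_order_trace_eq_dim:
  assumes A: "A \<in> carrier_mat n n" and k: "k > 0" "A ^\<^sub>m k = 1\<^sub>m n" and tr: "mat_trace A = of_nat n"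
  shows "A = 1\<^sub>m n"
proof -
  obtain B P Q where w: "similar_mat_wit A B P Q" and B: "B \<in> carrier_mat n n" "upper_triangular B"
    "B ^\<^sub>m k = 1\<^sub>m n" "\<forall>i<n. (B $$ (i,i)) ^ k = 1"
    "\<forall>m. mat_trace (A ^\<^sub>m m) = (\<Sum>i<n. (B $$ (i,i)) ^ m)"
    using finite_order_triangular[OF A k(2)] by blast
  have "B $$ (i,i) = 1" if "i < n" for i
  proof (rule sum_unit_complex_eq_card[of "{..<n}" "\<lambda>i. B $$ (i,i)"])
    show "cmod (B $$ (i, i)) = 1" if "i \<in> {..<n}" for i
      using B(4) that power_eq_1_iff[of "B $$ (i,i)" k] k by auto
    show "(\<Sum>i<n. B $$ (i, i)) = of_nat (card {..<n})"
      using B(5)[rule_format, of 1] A tr by simp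
  qed (use that in auto)
  hence "B = 1\<^sub>m n" using unipotent_finite_order[OF B(1,2) _ k(1) B(3)] by blast
  thus ?thesis using similar_mat_witD2[OF A w] by simp
qed

text \<open>Here \<open>A ^\<^sub>m k\<close> is the inverse of A, and inverting a root of unity is
  conjugating it.\<close>

lemma finite_order_trace_inverse:
  assumes A: "A \<in> carrier_mat n n" and k: "A ^\<^sub>m (Suc k) = 1\<^sub>m n"
  shows "mat_trace (A ^\<^sub>m k) = cnj (mat_trace A)"
proof -
  obtain B P Q where w: "similar_mat_wit A B P Q" and B: "B \<in> carrier_mat n n" "upper_triangular B"
    "B ^\<^sub>m Suc k = 1\<^sub>m n" "\<forall>i<n. (B $$ (i,i)) ^ Suc k = 1"
    "\<forall>m. mat_trace (A ^\<^sub>m m) = (\<Sum>i<n. (B $$ (i,i)) ^ m)"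
    using finite_order_triangular[OF A k] by blast
  have "(B $$ (i,i)) ^ k = cnj (B $$ (i,i))" if i: "i < n" for i
  proof -
    have "cmod (B $$ (i,i)) = 1" using power_eq_1_iff[OF B(4)[rule_format, OF i]] by simp
    hence "B $$ (i,i) * cnj (B $$ (i,i)) = 1" by (simp add: complex_norm_square[symmetric])
    hence "(B $$ (i,i)) ^ k = (B $$ (i,i)) ^ k * (B $$ (i,i) * cnj (B $$ (i,i)))" by simp
    also have "\<dots> = (B $$ (i,i)) ^ Suc k * cnj (B $$ (i,i))" by (simp only: power_Suc2 mult.assoc)
    finally show ?thesis by (simp only: B(4)[rule_format, OF i] mult_1)
  qed
  thus ?thesis using B(5)[rule_format, of k] B(5)[rule_format, of 1] A by simp
qed

section \<open>Representations of finite groups\<close>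

lemma mat_eqI_mult_vec:
  fixes A B :: "'a :: comm_ring_1 mat"
  assumes A: "A \<in> carrier_mat n m" and B: "B \<in> carrier_mat n m"
    and eq: "\<And>v. v \<in> carrier_vec m \<Longrightarrow> A *\<^sub>v v = B *\<^sub>v v"
  shows "A = B"
proof (rule eq_matI)
  fix i j assume ij: "i < dim_row B" "j < dim_col B"
  have "(A *\<^sub>v unit_vec m j) $ i = (B *\<^sub>v unit_vec m j) $ i" using eq by simp
  thus "A $$ (i,j) = B $$ (i,j)" using A B ij by simp
qed (use A B in auto)

text \<open>Every fibre of f on S is a right coset of K. The fibre condition takes the place of a
  homomorphism, so one count serves both the scalars of a representation and the coset map of a
  quotient.\<close>

lemma (in group) card_eq_kernel_times_image:
  assumes fin: "finite S" and S: "subgroup S G" and K: "K \<subseteq> S"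
    and f: "\<And>x y. x \<in> S \<Longrightarrow> y \<in> S \<Longrightarrow> f x = f y \<longleftrightarrow> x \<otimes> inv y \<in> K"
  shows "card S = card K * card (f ` S)"
proof -
  have Sc: "x \<in> carrier G" if "x \<in> S" for x using subgroup.mem_carrier[OF S that] .
  have "card {x \<in> S. f x = y} = card K" if "y \<in> f ` S" for y
  proof -
    from that obtain s where s: "s \<in> S" "y = f s" by auto
    have "{x \<in> S. f x = y} = (\<lambda>k. k \<otimes> s) ` K"
    proof (intro equalityI subsetI)
      fix x assume "x \<in> {x \<in> S. f x = y}"
      hence x: "x \<in> S" "x \<otimes> inv s \<in> K" using f s by auto
      moreover have "x = (x \<otimes> inv s) \<otimes> s" using x s Sc by (simp add: m_assoc)
      ultimately show "x \<in> (\<lambda>k. k \<otimes> s) ` K" by blast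
    next
      fix x assume "x \<in> (\<lambda>k. k \<otimes> s) ` K"
      then obtain k where k: "k \<in> K" "x = k \<otimes> s" by auto
      have "x \<in> S" using k K s S by (auto intro: subgroup.m_closed)
      moreover have "x \<otimes> inv s = k" using k s K Sc by (auto simp: m_assoc subset_iff)
      ultimately show "x \<in> {x \<in> S. f x = y}" using f s k by auto
    qed
    moreover have "inj_on (\<lambda>k. k \<otimes> s) K"
      using s K Sc by (intro inj_onI) (auto simp: subset_iff)
    ultimately show ?thesis by (simp add: card_image)
  qed
  hence "(\<Sum>y\<in>f ` S. card {x \<in> S. f x = y}) = card K * card (f ` S)" by (simp add: mult.commute)
  moreover have "card S = (\<Sum>y\<in>f ` S. card {x \<in> S. f x = y})"
    using sum.image_gen[OF fin, of "\<lambda>_. 1::nat" f] by simp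
  ultimately show ?thesis by simp
qed

locale finite_rep = group G for G (structure) +
  fixes n :: nat and \<rho> :: "'a \<Rightarrow> complex mat"
  assumes fin: "finite (carrier G)" and rep: "is_rep G n \<rho>"
begin

definition rep_ker :: "'a set" where
  "rep_ker = {g \<in> carrier G. \<rho> g = 1\<^sub>m n}"

text \<open>For irreducible \<rho> this is the center Z(chi) of its character.\<close>

definition rep_center :: "'a set" where
  "rep_center = {g \<in> carrier G. \<exists>c. \<rho> g = c \<cdot>\<^sub>m 1\<^sub>m n}"

lemma rho_carrier [simp]: "g \<in> carrier G \<Longrightarrow> \<rho> g \<in> carrier_mat n n"
  using rep by (simp add: is_rep_def)

lemma rho_vec_carrier [simp]:
  "g \<in> carrier G \<Longrightarrow> v \<in> carrier_vec n \<Longrightarrow> \<rho> g *\<^sub>v v \<in> carrier_vec n"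
  by (rule mult_mat_vec_carrier[OF rho_carrier])

lemma rho_dim [simp]: "g \<in> carrier G \<Longrightarrow> dim_row (\<rho> g) = n" "g \<in> carrier G \<Longrightarrow> dim_col (\<rho> g) = n"
  using rho_carrier carrier_matD by blast+

lemma rho_one [simp]: "\<rho> \<one> = 1\<^sub>m n"
  using rep by (simp add: is_rep_def)

lemma rho_mult: "g \<in> carrier G \<Longrightarrow> h \<in> carrier G \<Longrightarrow> \<rho> (g \<otimes> h) = \<rho> g * \<rho> h"
  using rep by (simp add: is_rep_def)

lemma rho_inv: "g \<in> carrier G \<Longrightarrow> \<rho> g * \<rho> (inv g) = 1\<^sub>m n" "g \<in> carrier G \<Longrightarrow> \<rho> (inv g) * \<rho> g = 1\<^sub>m n"
  using rho_mult[of g "inv g"] rho_mult[of "inv g" g] by simp_all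

lemma rho_pow: "g \<in> carrier G \<Longrightarrow> \<rho> (g [^] (k::nat)) = \<rho> g ^\<^sub>m k"
  by (induction k) (simp_all add: rho_mult)

lemma rho_mult_entry:
  assumes "g \<in> carrier G" "h \<in> carrier G" "i < n" "j < n"
  shows "\<rho> (g \<otimes> h) $$ (i,j) = (\<Sum>k<n. \<rho> g $$ (i,k) * \<rho> h $$ (k,j))"
  using assms by (simp add: rho_mult scalar_prod_def lessThan_atLeast0)

lemma rho_finite_order: "g \<in> carrier G \<Longrightarrow> \<rho> g ^\<^sub>m order G = 1\<^sub>m n"
  by (simp add: rho_pow[symmetric] pow_order_eq_1)

lemma order_pos: "order G > 0"
  using fin order_gt_0_iff_finite by simp

lemma trace_inv:
  assumes g: "g \<in> carrier G"
  shows "mat_trace (\<rho> (inv g)) = cnj (mat_trace (\<rho> g))"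
proof -
  obtain k where k: "order G = Suc k" using order_pos gr0_implies_Suc by blast
  hence "inv g = g [^] k" using inv_equality[of "g [^] k" g] pow_order_eq_1[OF g] g unfolding k by simp
  thus ?thesis
    using finite_order_trace_inverse[of "\<rho> g" n k] rho_finite_order[OF g] g by (simp add: k rho_pow)
qed

lemma rep_ker_eq_trace: "rep_ker = {g \<in> carrier G. mat_trace (\<rho> g) = of_nat n}"
proof -
  have "\<rho> g = 1\<^sub>m n \<longleftrightarrow> mat_trace (\<rho> g) = of_nat n" if "g \<in> carrier G" for g
    using finite_order_trace_eq_dim[OF rho_carrier[OF that] order_pos rho_finite_order[OF that]] by auto
  thus ?thesis unfolding rep_ker_def by blast
qed

lemma rho_inv_eq_iff:
  assumes "x \<in> carrier G" "y \<in> carrier G"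
  shows "\<rho> x = \<rho> y \<longleftrightarrow> x \<otimes> inv y \<in> rep_ker"
proof
  assume "\<rho> x = \<rho> y"
  thus "x \<otimes> inv y \<in> rep_ker" using assms rho_inv by (simp add: rep_ker_def rho_mult)
next
  assume "x \<otimes> inv y \<in> rep_ker"
  hence "\<rho> (x \<otimes> inv y \<otimes> y) = \<rho> y" using assms by (simp add: rep_ker_def rho_mult[of "x \<otimes> inv y" y])
  thus "\<rho> x = \<rho> y" using assms by (simp add: m_assoc)
qed

lemma rep_ker_subgroup: "subgroup rep_ker G"
proof (rule subgroupI)
  show "inv a \<in> rep_ker" if "a \<in> rep_ker" for a
    using that rho_inv(1)[of a] by (auto simp: rep_ker_def)
  show "a \<otimes> b \<in> rep_ker" if "a \<in> rep_ker" "b \<in> rep_ker" for a b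
    using that by (auto simp: rep_ker_def rho_mult)
qed (auto simp: rep_ker_def)

lemma rep_ker_normal: "rep_ker \<lhd> G"
  unfolding normal_inv_iff
proof (intro conjI ballI rep_ker_subgroup)
  fix x h assume "x \<in> carrier G" "h \<in> rep_ker"
  thus "x \<otimes> h \<otimes> inv x \<in> rep_ker" using rho_inv by (simp add: rep_ker_def rho_mult)
qed

lemma commutator_in_rep_ker_iff:
  assumes "x \<in> carrier G" "y \<in> carrier G"
  shows "x \<otimes> y \<otimes> inv x \<otimes> inv y \<in> rep_ker \<longleftrightarrow> \<rho> x * \<rho> y = \<rho> y * \<rho> x"
proof -
  have "x \<otimes> y \<otimes> inv x \<otimes> inv y = (x \<otimes> y) \<otimes> inv (y \<otimes> x)"
    using assms by (simp add: inv_mult_group m_assoc)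
  thus ?thesis using assms rho_inv_eq_iff[of "x \<otimes> y" "y \<otimes> x"] by (simp add: rho_mult)
qed

text \<open>This is the restriction of \<rho> to W in coordinates. By invariance \<rho> g B x stays
  in W, where B * C acts as the identity, and this makes C \<rho> B multiplicative. The last two
  clauses give a smaller positive dimension for a proper nonzero W.\<close>

lemma subrep:
  assumes W: "invariant_subspace G n \<rho> W"
  obtains d B C where "B \<in> carrier_mat n d" "C \<in> carrier_mat d n" "C * B = 1\<^sub>m d"
    "is_rep G d (\<lambda>g. C * \<rho> g * B)"
    "\<forall>g\<in>carrier G. \<forall>x\<in>carrier_vec d. B *\<^sub>v ((C * \<rho> g * B) *\<^sub>v x) = \<rho> g *\<^sub>v (B *\<^sub>v x)"
    "\<forall>x\<in>carrier_vec d. B *\<^sub>v x \<in> W"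
    "W \<noteq> {0\<^sub>v n} \<longrightarrow> d > 0" "W \<noteq> carrier_vec n \<longrightarrow> d < n"
proof -
  note W' = W[unfolded invariant_subspace_def]
  obtain d B C where B: "B \<in> carrier_mat n d" and C: "C \<in> carrier_mat d n" and CB: "C * B = 1\<^sub>m d"
    and BW: "\<And>x. x \<in> carrier_vec d \<Longrightarrow> B *\<^sub>v x \<in> W" and BCW: "\<And>w. w \<in> W \<Longrightarrow> B *\<^sub>v (C *\<^sub>v w) = w"
  proof (rule subspace_coordinates[of W n])
    show "W \<subseteq> carrier_vec n" "0\<^sub>v n \<in> W" using W' by blast+
    show "v + w \<in> W" if "v \<in> W" "w \<in> W" for v w using W' that by blast
    show "c \<cdot>\<^sub>v v \<in> W" if "v \<in> W" for c v using W' that by blast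
  qed blast
  have R: "C * \<rho> g * B \<in> carrier_mat d d" if "g \<in> carrier G" for g using B C that by auto
  have Rv: "(C * \<rho> g * B) *\<^sub>v x = C *\<^sub>v (\<rho> g *\<^sub>v (B *\<^sub>v x))" if "g \<in> carrier G" "x \<in> carrier_vec d" for g x
    using B C that by (simp add: assoc_mult_mat_vec[of _ d n _ n] assoc_mult_mat_vec[of _ d n _ d])
  have int: "B *\<^sub>v ((C * \<rho> g * B) *\<^sub>v x) = \<rho> g *\<^sub>v (B *\<^sub>v x)" if "g \<in> carrier G" "x \<in> carrier_vec d" for g x
    unfolding Rv[OF that] using that W' BW by (intro BCW) auto
  have "C * \<rho> (g \<otimes> h) * B = (C * \<rho> g * B) * (C * \<rho> h * B)" if gh: "g \<in> carrier G" "h \<in> carrier G" for g h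
  proof (rule mat_eqI_mult_vec[of _ d d])
    fix v :: "complex vec" assume v: "v \<in> carrier_vec d"
    have "((C * \<rho> g * B) * (C * \<rho> h * B)) *\<^sub>v v = (C * \<rho> g * B) *\<^sub>v ((C * \<rho> h * B) *\<^sub>v v)"
      using R gh v by (intro assoc_mult_mat_vec) auto
    also have "\<dots> = C *\<^sub>v (\<rho> g *\<^sub>v (\<rho> h *\<^sub>v (B *\<^sub>v v)))"
      using mult_mat_vec_carrier[OF R[OF gh(2)] v] gh v by (subst Rv) (auto simp: int)
    also have "\<dots> = (C * \<rho> (g \<otimes> h) * B) *\<^sub>v v"
    proof -
      have Bv: "B *\<^sub>v v \<in> carrier_vec n" using B v by simp
      show ?thesis
        using Rv[of "g \<otimes> h" v] gh v assoc_mult_mat_vec[OF rho_carrier[OF gh(1)] rho_carrier[OF gh(2)] Bv]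
        by (simp add: rho_mult)
    qed
    finally show "(C * \<rho> (g \<otimes> h) * B) *\<^sub>v v = ((C * \<rho> g * B) * (C * \<rho> h * B)) *\<^sub>v v" by simp
  qed (use mult_carrier_mat[OF R[OF gh(1)] R[OF gh(2)]] R gh in auto)
  hence "is_rep G d (\<lambda>g. C * \<rho> g * B)" using R C CB by (auto simp: is_rep_def)
  moreover have "d > 0" if ne: "W \<noteq> {0\<^sub>v n}"
  proof (rule ccontr)
    assume "\<not> d > 0"
    hence "B *\<^sub>v (C *\<^sub>v w) = 0\<^sub>v n" for w
      using B C by (intro eq_vecI) (auto simp: scalar_prod_def)
    hence "w = 0\<^sub>v n" if "w \<in> W" for w using BCW[OF that] by simp
    thus False using ne W' by auto
  qed
  moreover have "d < n" if ne: "W \<noteq> carrier_vec n"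
  proof (rule ccontr)
    assume "\<not> d < n"
    hence d: "d = n" using right_inverse_dim_le[OF C B CB] by simp
    have BC: "B * C = 1\<^sub>m n" using mat_mult_left_right_inverse[of C n B] B C CB d by simp
    have "x \<in> W" if x: "x \<in> carrier_vec n" for x
    proof -
      have "B *\<^sub>v (C *\<^sub>v x) = x" using assoc_mult_mat_vec[OF B C x] BC x by simp
      thus ?thesis using BW[of "C *\<^sub>v x"] C x d by simp
    qed
    thus False using ne W' by auto
  qed
  ultimately show thesis using int BW by (intro that[OF B C CB]) auto
qed

text \<open>The image W of \<rho> z - 1 is invariant because \<rho> z commutes with everything, and
  nonzero because \<rho> z is not the identity. If w = \<rho> z v - v is fixed by z, then z^k sends
  v to v + k w; taking k = |G| gives w = 0. So W carries the desired representation.\<close>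

lemma exists_rep_without_fixed_vectors:
  assumes z: "z \<in> carrier G" "\<rho> z \<noteq> 1\<^sub>m n" and central: "\<And>g. g \<in> carrier G \<Longrightarrow> \<rho> z * \<rho> g = \<rho> g * \<rho> z"
  shows "\<exists>d>0. \<exists>\<sigma>. is_rep G d \<sigma> \<and> (\<forall>v\<in>carrier_vec d. \<sigma> z *\<^sub>v v = v \<longrightarrow> v = 0\<^sub>v d)"
proof -
  define W where "W = {\<rho> z *\<^sub>v v - v | v. v \<in> carrier_vec n}"
  have WI: "\<rho> z *\<^sub>v v - v \<in> W" if "v \<in> carrier_vec n" for v using that by (auto simp: W_def)
  have inv: "invariant_subspace G n \<rho> W"
    unfolding invariant_subspace_def
  proof (intro conjI ballI allI)
    show "W \<subseteq> carrier_vec n"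
    proof
      fix w assume "w \<in> W"
      then obtain v where v: "v \<in> carrier_vec n" "w = \<rho> z *\<^sub>v v - v" unfolding W_def by blast
      have "\<rho> z *\<^sub>v v \<in> carrier_vec n" using mult_mat_vec_carrier[OF rho_carrier[OF z(1)] v(1)] .
      thus "w \<in> carrier_vec n" using v by simp
    qed
    have "\<rho> z *\<^sub>v 0\<^sub>v n - 0\<^sub>v n = 0\<^sub>v n" by (intro eq_vecI) (simp_all add: z(1))
    thus "0\<^sub>v n \<in> W" using WI[of "0\<^sub>v n"] by simp
    fix v assume "v \<in> W"
    then obtain x where x: "x \<in> carrier_vec n" "v = \<rho> z *\<^sub>v x - x" by (auto simp: W_def)
    {
      fix w assume "w \<in> W"
      then obtain y where y: "y \<in> carrier_vec n" "w = \<rho> z *\<^sub>v y - y" by (auto simp: W_def)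
      have "v + w = \<rho> z *\<^sub>v (x + y) - (x + y)"
        using x y z by (intro eq_vecI) (auto simp: mult_add_distrib_mat_vec[OF rho_carrier])
      thus "v + w \<in> W" using WI[of "x + y"] x y by simp
    }
    {
      fix c :: complex
      have "c \<cdot>\<^sub>v v = \<rho> z *\<^sub>v (c \<cdot>\<^sub>v x) - c \<cdot>\<^sub>v x"
        using x z by (intro eq_vecI) (auto simp: mult_mat_vec[OF rho_carrier] algebra_simps)
      thus "c \<cdot>\<^sub>v v \<in> W" using WI[of "c \<cdot>\<^sub>v x"] x by simp
    }
    {
      fix g assume g: "g \<in> carrier G"
      have "\<rho> g *\<^sub>v v = \<rho> g *\<^sub>v (\<rho> z *\<^sub>v x) - \<rho> g *\<^sub>v x"
        unfolding x(2) using mult_mat_vec_carrier[OF rho_carrier[OF z(1)] x(1)] x(1) g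
        by (intro mult_minus_distrib_mat_vec) auto
      also have "\<rho> g *\<^sub>v (\<rho> z *\<^sub>v x) = \<rho> z *\<^sub>v (\<rho> g *\<^sub>v x)"
        using assoc_mult_mat_vec[OF rho_carrier rho_carrier x(1), OF g z(1)]
          assoc_mult_mat_vec[OF rho_carrier rho_carrier x(1), OF z(1) g] central[OF g] by simp
      finally show "\<rho> g *\<^sub>v v \<in> W" using WI[of "\<rho> g *\<^sub>v x"] x g by simp
    }
  qed
  have W_no_fixed: "w = 0\<^sub>v n" if w: "w \<in> W" "\<rho> z *\<^sub>v w = w" for w
  proof -
    obtain v where v: "v \<in> carrier_vec n" "w = \<rho> z *\<^sub>v v - v" using w by (auto simp: W_def)
    have wc: "w \<in> carrier_vec n" using v z by simp
    have zv: "\<rho> z *\<^sub>v v = v + w" using v z by (intro eq_vecI) auto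
    have "\<rho> (z [^] k) *\<^sub>v v = v + of_nat k \<cdot>\<^sub>v w" for k :: nat
    proof (induction k)
      case 0
      show ?case using v wc by (intro eq_vecI) auto
    next
      case (Suc k)
      have "\<rho> (z [^] Suc k) *\<^sub>v v = \<rho> z *\<^sub>v (\<rho> (z [^] k) *\<^sub>v v)"
        using z v by (subst nat_pow_Suc2) (auto simp: rho_mult assoc_mult_mat_vec[of _ n n _ n])
      also have "\<dots> = \<rho> z *\<^sub>v v + of_nat k \<cdot>\<^sub>v (\<rho> z *\<^sub>v w)"
        using z v wc unfolding Suc
        by (simp add: mult_add_distrib_mat_vec[OF rho_carrier] mult_mat_vec[OF rho_carrier])
      also have "\<dots> = v + of_nat (Suc k) \<cdot>\<^sub>v w"
        unfolding zv w(2) using v(1) wc by (intro eq_vecI) (auto simp: algebra_simps)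
      finally show ?case .
    qed
    from this[of "order G"] have eq: "v = v + of_nat (order G) \<cdot>\<^sub>v w"
      using z v(1) by (simp add: pow_order_eq_1)
    show ?thesis
    proof (rule eq_vecI)
      fix i assume i: "i < dim_vec (0\<^sub>v n :: complex vec)"
      hence "v $ i = v $ i + of_nat (order G) * w $ i"
        using arg_cong[OF eq, of "\<lambda>u. u $ i"] v(1) wc by simp
      thus "w $ i = 0\<^sub>v n $ i" using order_pos i by simp
    qed (use wc in auto)
  qed
  obtain d B C where sub: "B \<in> carrier_mat n d" "C \<in> carrier_mat d n" "C * B = 1\<^sub>m d"
    "is_rep G d (\<lambda>g. C * \<rho> g * B)"
    "\<forall>g\<in>carrier G. \<forall>x\<in>carrier_vec d. B *\<^sub>v ((C * \<rho> g * B) *\<^sub>v x) = \<rho> g *\<^sub>v (B *\<^sub>v x)"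
    "\<forall>x\<in>carrier_vec d. B *\<^sub>v x \<in> W" "W \<noteq> {0\<^sub>v n} \<longrightarrow> d > 0" "W \<noteq> carrier_vec n \<longrightarrow> d < n"
    by (rule subrep[OF inv])
  have "W \<noteq> {0\<^sub>v n}"
  proof
    assume W0: "W = {0\<^sub>v n}"
    have "\<rho> z = 1\<^sub>m n"
    proof (rule mat_eqI_mult_vec[of _ n n])
      fix v :: "complex vec" assume v: "v \<in> carrier_vec n"
      have "\<rho> z *\<^sub>v v - v = 0\<^sub>v n" using WI[OF v] W0 by simp
      hence "(\<rho> z *\<^sub>v v - v) $ i = 0" if "i < n" for i using that by simp
      thus "\<rho> z *\<^sub>v v = 1\<^sub>m n *\<^sub>v v" using v z by (intro eq_vecI) auto
    qed (use z in auto)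
    thus False using z by simp
  qed
  moreover have "x = 0\<^sub>v d" if x: "x \<in> carrier_vec d" "(C * \<rho> z * B) *\<^sub>v x = x" for x
  proof -
    have "\<rho> z *\<^sub>v (B *\<^sub>v x) = B *\<^sub>v x" using sub(5)[rule_format, OF z(1) x(1)] x by simp
    hence "B *\<^sub>v x = 0\<^sub>v n" using W_no_fixed sub(6) x by blast
    moreover have "C *\<^sub>v (B *\<^sub>v x) = x" using assoc_mult_mat_vec[OF sub(2,1) x(1)] sub(3) x by simp
    moreover have "C *\<^sub>v 0\<^sub>v n = 0\<^sub>v d" using sub(2) by (intro eq_vecI) auto
    ultimately show ?thesis by simp
  qed
  ultimately show ?thesis using sub(4,7) by blast
qed

end

section \<open>Schur's lemma, orthogonality and the center of an irreducible character\<close>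

locale finite_irr_rep = finite_rep +
  assumes irr: "irr_rep G n \<rho>"
begin

lemma dim_pos: "n > 0"
  using irr by (simp add: irr_rep_def)

lemma schur:
  assumes A: "A \<in> carrier_mat n n" and comm: "\<And>g. g \<in> carrier G \<Longrightarrow> \<rho> g * A = A * \<rho> g"
  obtains c where "A = c \<cdot>\<^sub>m 1\<^sub>m n"
proof -
  obtain c where c: "eigenvalue A c" using spectrum_non_empty[OF A dim_pos] by (auto simp: spectrum_def)
  define W where "W = {v \<in> carrier_vec n. A *\<^sub>v v = c \<cdot>\<^sub>v v}"
  have "invariant_subspace G n \<rho> W"
    unfolding invariant_subspace_def
  proof (intro conjI ballI allI)
    fix v assume v: "v \<in> W"
    show "v + w \<in> W" if "w \<in> W" for w
      using v that A by (auto simp: W_def mult_add_distrib_mat_vec[OF A] smult_add_distrib_vec[of _ n])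
    show "b \<cdot>\<^sub>v v \<in> W" for b
      using v A by (auto simp: W_def mult_mat_vec[OF A] smult_smult_assoc mult.commute)
    show "\<rho> g *\<^sub>v v \<in> W" if g: "g \<in> carrier G" for g
    proof -
      have vc: "v \<in> carrier_vec n" "A *\<^sub>v v = c \<cdot>\<^sub>v v" using v by (auto simp: W_def)
      have "A *\<^sub>v (\<rho> g *\<^sub>v v) = \<rho> g *\<^sub>v (A *\<^sub>v v)"
        using assoc_mult_mat_vec[OF A rho_carrier vc(1), OF g]
          assoc_mult_mat_vec[OF rho_carrier A vc(1), OF g] comm[OF g] by simp
      thus ?thesis using vc mult_mat_vec_carrier[OF rho_carrier[OF g] vc(1)] g
        by (simp add: W_def mult_mat_vec[OF rho_carrier])
    qed
  qed (use A in \<open>auto simp: W_def\<close>)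
  moreover have "W \<noteq> {0\<^sub>v n}"
    using c A by (auto simp: W_def eigenvalue_def eigenvector_def)
  ultimately have "W = carrier_vec n" using irr by (auto simp: irr_rep_def)
  hence "A *\<^sub>v v = (c \<cdot>\<^sub>m 1\<^sub>m n) *\<^sub>v v" if "v \<in> carrier_vec n" for v
  proof -
    have "v \<in> W" using that \<open>W = carrier_vec n\<close> by simp
    thus ?thesis using that by (intro eq_vecI) (auto simp: W_def)
  qed
  hence "A = c \<cdot>\<^sub>m 1\<^sub>m n" using A by (intro mat_eqI_mult_vec[of _ n n]) auto
  thus thesis by (rule that)
qed

lemma sum_reindex_mult_left:
  assumes "h \<in> carrier G"
  shows "(\<Sum>g\<in>carrier G. f (h \<otimes> g)) = (\<Sum>g\<in>carrier G. f g)"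
proof (rule sum.reindex_bij_witness[of _ "\<lambda>g. inv h \<otimes> g" "\<lambda>g. h \<otimes> g"])
qed (use assms in \<open>auto simp: m_assoc[symmetric]\<close>)

lemma sum_matrix_coefficients:
  assumes i: "i < n" and j: "j < n"
  shows "(\<Sum>g\<in>carrier G. \<rho> g $$ (i,i) * \<rho> (inv g) $$ (j,j)) =
    (if i = j then of_nat (order G) / of_nat n else 0)"
proof -
  \<comment> \<open>M is the sum of \<rho> g E \<rho> g^-1 over the group, with E the matrix unit at
    (i,j). It commutes with \<rho>, so it is scalar, and its trace identifies the scalar.\<close>
  define M where "M = mat n n (\<lambda>(a,b). \<Sum>g\<in>carrier G. \<rho> g $$ (a,i) * \<rho> (inv g) $$ (j,b))"
  have M: "M \<in> carrier_mat n n" by (simp add: M_def)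
  have "\<rho> h * M = M * \<rho> h" if h: "h \<in> carrier G" for h
  proof (rule eq_matI)
    fix a b assume "a < dim_row (M * \<rho> h)" "b < dim_col (M * \<rho> h)"
    hence ab: "a < n" "b < n" using M h by auto
    have "(\<rho> h * M) $$ (a,b) = (\<Sum>c<n. \<rho> h $$ (a,c) * (\<Sum>g\<in>carrier G. \<rho> g $$ (c,i) * \<rho> (inv g) $$ (j,b)))"
      using ab h by (simp add: M_def scalar_prod_def lessThan_atLeast0)
    also have "\<dots> = (\<Sum>c<n. \<Sum>g\<in>carrier G. \<rho> h $$ (a,c) * \<rho> g $$ (c,i) * \<rho> (inv g) $$ (j,b))"
      by (simp add: sum_distrib_left mult.assoc)
    also have "\<dots> = (\<Sum>g\<in>carrier G. \<Sum>c<n. \<rho> h $$ (a,c) * \<rho> g $$ (c,i) * \<rho> (inv g) $$ (j,b))"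
      by (rule sum.swap)
    also have "\<dots> = (\<Sum>g\<in>carrier G. \<rho> (h \<otimes> g) $$ (a,i) * \<rho> (inv g) $$ (j,b))"
      using h i ab by (intro sum.cong refl) (simp add: rho_mult_entry sum_distrib_right)
    also have "\<dots> = (\<Sum>g\<in>carrier G. \<rho> (h \<otimes> g) $$ (a,i) * \<rho> (inv (h \<otimes> g) \<otimes> h) $$ (j,b))"
      using h by (intro sum.cong refl) (simp add: inv_mult_group m_assoc)
    also have "\<dots> = (\<Sum>g\<in>carrier G. \<rho> g $$ (a,i) * \<rho> (inv g \<otimes> h) $$ (j,b))"
      using sum_reindex_mult_left[OF h, of "\<lambda>g. \<rho> g $$ (a,i) * \<rho> (inv g \<otimes> h) $$ (j,b)"] .
    also have "\<dots> = (\<Sum>g\<in>carrier G. \<Sum>c<n. \<rho> g $$ (a,i) * \<rho> (inv g) $$ (j,c) * \<rho> h $$ (c,b))"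
      using h j ab by (intro sum.cong refl) (simp add: rho_mult_entry sum_distrib_left mult.assoc)
    also have "\<dots> = (\<Sum>c<n. \<Sum>g\<in>carrier G. \<rho> g $$ (a,i) * \<rho> (inv g) $$ (j,c) * \<rho> h $$ (c,b))"
      by (rule sum.swap)
    also have "\<dots> = (M * \<rho> h) $$ (a,b)"
      using ab h by (simp add: M_def scalar_prod_def lessThan_atLeast0 sum_distrib_right)
    finally show "(\<rho> h * M) $$ (a,b) = (M * \<rho> h) $$ (a,b)" .
  qed (use M h in auto)
  then obtain c where c: "M = c \<cdot>\<^sub>m 1\<^sub>m n" using schur[OF M] by blast
  have "of_nat n * c = mat_trace M" by (simp add: c)
  also have "\<dots> = (\<Sum>a<n. \<Sum>g\<in>carrier G. \<rho> (inv g) $$ (j,a) * \<rho> g $$ (a,i))"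
    by (simp add: M_def mat_trace_def mult.commute)
  also have "\<dots> = (\<Sum>g\<in>carrier G. \<Sum>a<n. \<rho> (inv g) $$ (j,a) * \<rho> g $$ (a,i))"
    by (rule sum.swap)
  also have "\<dots> = (\<Sum>g\<in>carrier G. \<rho> (inv g \<otimes> g) $$ (j,i))"
    using i j by (intro sum.cong refl) (simp only: rho_mult_entry inv_closed)
  also have "\<dots> = (if i = j then of_nat (order G) else 0)"
    using i j by (simp add: order_def)
  finally have "c = (if i = j then of_nat (order G) / of_nat n else 0)"
    using dim_pos by (auto simp: field_simps split: if_splits)
  moreover have "(\<Sum>g\<in>carrier G. \<rho> g $$ (i,i) * \<rho> (inv g) $$ (j,j)) = M $$ (i,j)"
    using i j by (simp add: M_def)
  ultimately show ?thesis using i j by (auto simp: c)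
qed

text \<open>This is the relation [chi, chi] = 1, scaled by the group order.\<close>

lemma sum_norm_trace: "(\<Sum>g\<in>carrier G. (cmod (mat_trace (\<rho> g)))\<^sup>2) = real (order G)"
proof -
  have "of_real (\<Sum>g\<in>carrier G. (cmod (mat_trace (\<rho> g)))\<^sup>2)
      = (\<Sum>g\<in>carrier G. mat_trace (\<rho> g) * mat_trace (\<rho> (inv g)))"
    unfolding of_real_sum by (intro sum.cong refl) (simp add: trace_inv complex_norm_square del: of_real_power)
  also have "\<dots> = (\<Sum>g\<in>carrier G. \<Sum>i<n. \<Sum>j<n. \<rho> g $$ (i,i) * \<rho> (inv g) $$ (j,j))"
    by (intro sum.cong refl) (simp add: mat_trace_def sum_product)
  also have "\<dots> = (\<Sum>i<n. \<Sum>g\<in>carrier G. \<Sum>j<n. \<rho> g $$ (i,i) * \<rho> (inv g) $$ (j,j))"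
    by (rule sum.swap)
  also have "\<dots> = (\<Sum>i<n. \<Sum>j<n. \<Sum>g\<in>carrier G. \<rho> g $$ (i,i) * \<rho> (inv g) $$ (j,j))"
    by (intro sum.cong refl sum.swap)
  also have "\<dots> = (\<Sum>i<n. \<Sum>j<n. if i = j then of_nat (order G) / of_nat n else 0)"
    by (simp add: sum_matrix_coefficients)
  also have "\<dots> = of_real (real (order G))" using dim_pos by simp
  finally show ?thesis by (simp only: of_real_eq_iff)
qed

lemma rep_centerI:
  assumes "g \<in> carrier G" "\<And>h. h \<in> carrier G \<Longrightarrow> \<rho> h * \<rho> g = \<rho> g * \<rho> h"
  shows "g \<in> rep_center"
  using schur[of "\<rho> g"] assms unfolding rep_center_def by auto

text \<open>On \<open>rep_center\<close> this is the linear character by which the center acts; the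
  entry (0,0) exists because n > 0 and reads off the scalar. Outside \<open>rep_center\<close> it
  carries no such meaning.\<close>

definition scalar :: "'a \<Rightarrow> complex" where
  "scalar g = \<rho> g $$ (0,0)"

lemma rho_scalar:
  assumes "g \<in> rep_center"
  shows "\<rho> g = scalar g \<cdot>\<^sub>m 1\<^sub>m n"
proof -
  obtain c where "\<rho> g = c \<cdot>\<^sub>m 1\<^sub>m n" using assms by (auto simp: rep_center_def)
  thus ?thesis using dim_pos by (simp add: scalar_def)
qed

lemma rep_center_carrier: "rep_center \<subseteq> carrier G"
  by (auto simp: rep_center_def)

lemma rep_center_commutes:
  assumes "g \<in> rep_center" "h \<in> carrier G"
  shows "\<rho> g * \<rho> h = \<rho> h * \<rho> g"
proof -
  have "(c \<cdot>\<^sub>m 1\<^sub>m n) * \<rho> h = \<rho> h * (c \<cdot>\<^sub>m 1\<^sub>m n)" for c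
    using assms mult_smult_assoc_mat[of "1\<^sub>m n" n n "\<rho> h" n c] mult_smult_distrib[of "\<rho> h" n n "1\<^sub>m n" n c]
    by simp
  thus ?thesis using assms by (auto simp: rep_center_def)
qed

lemma scalar_mult:
  assumes "g \<in> rep_center" "h \<in> rep_center"
  shows "scalar (g \<otimes> h) = scalar g * scalar h"
proof -
  have gh: "g \<in> carrier G" "h \<in> carrier G" using assms by (auto simp: rep_center_def)
  have "\<rho> (g \<otimes> h) = scalar g \<cdot>\<^sub>m (scalar h \<cdot>\<^sub>m 1\<^sub>m n)"
    using rho_scalar[OF assms(2)] rho_scalar[OF assms(1)] gh
      mult_smult_assoc_mat[of "1\<^sub>m n" n n "scalar h \<cdot>\<^sub>m 1\<^sub>m n" n "scalar g"] by (simp add: rho_mult)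
  thus ?thesis using dim_pos by (simp add: scalar_def)
qed

lemma rep_center_subgroup: "subgroup rep_center G"
proof (rule subgroupI)
  show "rep_center \<noteq> {}"
    using rep_ker_subgroup subgroup.one_closed rep_center_def by (auto intro!: exI[of _ \<one>] exI[of _ 1])
  fix a assume a: "a \<in> rep_center"
  hence ac: "a \<in> carrier G" by (simp add: rep_center_def)
  show "inv a \<in> rep_center"
  proof (rule rep_centerI)
    fix h assume h: "h \<in> carrier G"
    have "\<rho> (inv a) * (\<rho> a * \<rho> h) * \<rho> (inv a) = \<rho> (inv a) * (\<rho> h * \<rho> a) * \<rho> (inv a)"
      using rep_center_commutes[OF a h] by simp
    moreover have "\<rho> (inv a) * (\<rho> a * \<rho> h) * \<rho> (inv a) = \<rho> (inv a \<otimes> (a \<otimes> h) \<otimes> inv a)"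
      using ac h by (simp add: rho_mult)
    moreover have "inv a \<otimes> (a \<otimes> h) \<otimes> inv a = h \<otimes> inv a"
      using ac h by (simp add: m_assoc[symmetric])
    moreover have "\<rho> (inv a) * (\<rho> h * \<rho> a) * \<rho> (inv a) = \<rho> (inv a \<otimes> (h \<otimes> a) \<otimes> inv a)"
      using ac h by (simp add: rho_mult)
    moreover have "inv a \<otimes> (h \<otimes> a) \<otimes> inv a = inv a \<otimes> h"
      using ac h by (simp add: m_assoc)
    ultimately show "\<rho> h * \<rho> (inv a) = \<rho> (inv a) * \<rho> h" using ac h by (simp add: rho_mult)
  qed (use ac in simp)
  fix b assume b: "b \<in> rep_center"
  hence bc: "b \<in> carrier G" by (simp add: rep_center_def)
  show "a \<otimes> b \<in> rep_center"
  proof (rule rep_centerI)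
    fix h assume h: "h \<in> carrier G"
    have "\<rho> (a \<otimes> b) * \<rho> h = \<rho> a * (\<rho> b * \<rho> h)"
      using ac bc h by (simp add: rho_mult assoc_mult_mat[of _ n n _ n _ n])
    also have "\<dots> = \<rho> a * \<rho> h * \<rho> b"
      using ac bc h rep_center_commutes[OF b h] by (simp add: assoc_mult_mat[of _ n n _ n _ n])
    also have "\<dots> = \<rho> h * \<rho> (a \<otimes> b)"
      using ac bc h rep_center_commutes[OF a h] by (simp add: rho_mult assoc_mult_mat[of _ n n _ n _ n])
    finally show "\<rho> h * \<rho> (a \<otimes> b) = \<rho> (a \<otimes> b) * \<rho> h" by simp
  qed (use ac bc in simp)
qed (rule rep_center_carrier)

lemma scalar_pow:
  assumes "g \<in> rep_center"
  shows "scalar (g [^] (k::nat)) = scalar g ^ k" "g [^] k \<in> rep_center"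
proof -
  have "g [^] k \<in> rep_center \<and> scalar (g [^] k) = scalar g ^ k"
  proof (induction k)
    case 0
    thus ?case using subgroup.one_closed[OF rep_center_subgroup] dim_pos by (simp add: scalar_def)
  next
    case (Suc k)
    thus ?case using assms subgroup.m_closed[OF rep_center_subgroup] by (simp add: scalar_mult)
  qed
  thus "scalar (g [^] k) = scalar g ^ k" "g [^] k \<in> rep_center" by auto
qed

lemma scalar_eq_one_iff:
  assumes "g \<in> rep_center"
  shows "scalar g = 1 \<longleftrightarrow> g \<in> rep_ker"
proof
  assume "scalar g = 1"
  hence "\<rho> g = 1\<^sub>m n" using rho_scalar[OF assms] by (auto intro!: eq_matI)
  thus "g \<in> rep_ker" using assms by (simp add: rep_ker_def rep_center_def)
next
  assume "g \<in> rep_ker"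
  thus "scalar g = 1" using dim_pos by (simp add: rep_ker_def scalar_def)
qed

lemma rep_ker_le_center: "rep_ker \<subseteq> rep_center"
proof
  fix g assume g: "g \<in> rep_ker"
  have "(1::complex) \<cdot>\<^sub>m 1\<^sub>m n = 1\<^sub>m n" by (intro eq_matI) auto
  thus "g \<in> rep_center" using g by (auto simp: rep_ker_def rep_center_def intro!: exI[of _ 1])
qed

text \<open>On S the map \<open>scalar\<close> has kernel S \<inter> \<open>rep_ker\<close>. An
  index thus becomes the size of a set of roots of unity, which the number of roots of a polynomial
  bounds.\<close>

lemma card_eq_card_ker_times_scalars:
  assumes S: "subgroup S G" "S \<subseteq> rep_center"
  shows "card S = card (S \<inter> rep_ker) * card (scalar ` S)"
proof (rule card_eq_kernel_times_image)
  show "finite S" by (rule finite_subset[OF subgroup.subset[OF S(1)] fin])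
  fix x y assume xy: "x \<in> S" "y \<in> S"
  hence xyZ: "x \<in> rep_center" "y \<in> rep_center" using S by auto
  have "\<rho> x = \<rho> y" if "scalar x = scalar y"
    using rho_scalar[OF xyZ(1)] rho_scalar[OF xyZ(2)] that by simp
  moreover have "scalar x = scalar y" if "\<rho> x = \<rho> y" using that by (simp add: scalar_def)
  ultimately have "scalar x = scalar y \<longleftrightarrow> \<rho> x = \<rho> y" by blast
  also have "\<dots> \<longleftrightarrow> x \<otimes> inv y \<in> rep_ker"
    using xyZ by (intro rho_inv_eq_iff) (auto simp: rep_center_def)
  also have "\<dots> \<longleftrightarrow> x \<otimes> inv y \<in> S \<inter> rep_ker"
    using xy S by (auto intro: subgroup.m_closed subgroup.m_inv_closed)
  finally show "scalar x = scalar y \<longleftrightarrow> x \<otimes> inv y \<in> S \<inter> rep_ker" .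
qed (use S in auto)

lemma norm_trace_center:
  assumes "g \<in> rep_center"
  shows "cmod (mat_trace (\<rho> g)) = real n"
proof -
  have "scalar g ^ order G = 1"
    using scalar_pow(1)[OF assms, of "order G"] assms dim_pos
    by (simp add: pow_order_eq_1 scalar_def rep_center_def)
  hence "cmod (scalar g) = 1" using power_eq_1_iff[of "scalar g" "order G"] order_pos by simp
  thus ?thesis using rho_scalar[OF assms] by (simp add: norm_mult)
qed

lemma sum_norm_trace_center: "(\<Sum>g\<in>rep_center. (cmod (mat_trace (\<rho> g)))\<^sup>2) = real (card rep_center * n\<^sup>2)"
  by (simp add: norm_trace_center)

text \<open>On the center |chi| equals n, so the center alone contributes |Z(chi)| n^2 to the sum of
  |chi|^2, which is |G|.\<close>

lemma card_center_mult_dim_le: "card rep_center * n\<^sup>2 \<le> order G"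
proof -
  have "real (card rep_center * n\<^sup>2) \<le> (\<Sum>g\<in>carrier G. (cmod (mat_trace (\<rho> g)))\<^sup>2)"
    unfolding sum_norm_trace_center[symmetric] using fin rep_center_carrier by (intro sum_mono2) auto
  thus ?thesis unfolding sum_norm_trace by linarith
qed

text \<open>The character vanishes off its center. For g outside choose h with \<rho> h not
  commuting with \<rho> g; the commutator x of g and h acts as a scalar other than 1, and g = x (h g
  h^-1) gives chi(g) = \<open>scalar x\<close> chi(g).\<close>

lemma card_center_mult_dim_eq:
  assumes "\<And>g h. g \<in> carrier G \<Longrightarrow> h \<in> carrier G \<Longrightarrow> g \<otimes> h \<otimes> inv g \<otimes> inv h \<in> rep_center"
  shows "card rep_center * n\<^sup>2 = order G"
proof -
  have "mat_trace (\<rho> g) = 0" if g: "g \<in> carrier G" "g \<notin> rep_center" for g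
  proof -
    obtain h where h: "h \<in> carrier G" "\<rho> h * \<rho> g \<noteq> \<rho> g * \<rho> h" using rep_centerI[OF g(1)] g(2) by blast
    define x where "x = g \<otimes> h \<otimes> inv g \<otimes> inv h"
    have x: "x \<in> rep_center" unfolding x_def using assms g h by blast
    hence xc: "x \<in> carrier G" by (simp add: rep_center_def)
    have "x \<notin> rep_ker" unfolding x_def using commutator_in_rep_ker_iff[OF g(1) h(1)] h by auto
    hence s: "scalar x \<noteq> 1" using scalar_eq_one_iff[OF x] by simp
    have gx: "g = x \<otimes> (h \<otimes> g \<otimes> inv h)"
      unfolding x_def using g h by (simp add: m_assoc) (simp add: m_assoc[symmetric])
    have "mat_trace (\<rho> g) = mat_trace (\<rho> x * (\<rho> h * \<rho> g * \<rho> (inv h)))"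
      by (subst gx) (use g h xc in \<open>simp add: rho_mult\<close>)
    also have "\<rho> x * (\<rho> h * \<rho> g * \<rho> (inv h)) = scalar x \<cdot>\<^sub>m (\<rho> h * \<rho> g * \<rho> (inv h))"
    proof -
      have M: "\<rho> h * \<rho> g * \<rho> (inv h) \<in> carrier_mat n n"
        using g h by (intro mult_carrier_mat) auto
      thus ?thesis using rho_scalar[OF x] left_mult_one_mat[OF M]
        mult_smult_assoc_mat[of "1\<^sub>m n" n n "\<rho> h * \<rho> g * \<rho> (inv h)" n "scalar x"] by simp
    qed
    also have "mat_trace \<dots> = scalar x * mat_trace (\<rho> h * \<rho> g * \<rho> (inv h))"
      using h g by (simp add: mat_trace_def sum_distrib_left)
    also have "mat_trace (\<rho> h * \<rho> g * \<rho> (inv h)) = mat_trace (\<rho> (inv h) * (\<rho> h * \<rho> g))"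
      using h g by (intro mat_trace_mult_comm) auto
    also have "\<rho> (inv h) * (\<rho> h * \<rho> g) = \<rho> (inv h \<otimes> (h \<otimes> g))" using h g by (simp add: rho_mult)
    also have "inv h \<otimes> (h \<otimes> g) = g" using h g by (simp add: m_assoc[symmetric])
    finally show ?thesis using s by simp
  qed
  hence "(\<Sum>g\<in>carrier G. (cmod (mat_trace (\<rho> g)))\<^sup>2) = (\<Sum>g\<in>rep_center. (cmod (mat_trace (\<rho> g)))\<^sup>2)"
    using fin rep_center_carrier by (intro sum.mono_neutral_right) auto
  hence "real (order G) = real (card rep_center * n\<^sup>2)"
    unfolding sum_norm_trace sum_norm_trace_center .
  thus ?thesis by linarith
qed

end

section \<open>Irreducible representations that are nontrivial on a given central element\<close>

lemma (in group) exists_faithful_rep: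
  assumes fin: "finite (carrier G)"
  shows "\<exists>n \<rho>. is_rep G n \<rho> \<and> (\<forall>g\<in>carrier G. \<rho> g = 1\<^sub>m n \<longrightarrow> g = \<one>)"
proof -
  obtain e where e: "bij_betw e {0..<order G} (carrier G)"
    using ex_bij_betw_nat_finite[OF fin] by (auto simp: order_def)
  define N where "N = order G"
  \<comment> \<open>The left regular representation as permutation matrices along the enumeration e.
    It is faithful because only the identity of the group fixes the basis vector belonging to
    \<open>\<one>\<close>.\<close>
  define R where "R g = mat N N (\<lambda>(i,j). if e i = g \<otimes> e j then 1 else (0::complex))" for g
  have ec: "e i \<in> carrier G" if "i < N" for i using that e by (auto simp: bij_betw_def N_def)
  have inj: "e i = e j \<longleftrightarrow> i = j" if "i < N" "j < N" for i j
    using that e by (auto simp: bij_betw_def N_def inj_on_def)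
  have surj: "\<exists>i<N. e i = x" if "x \<in> carrier G" for x
    using that e by (force simp: bij_betw_def N_def)
  have "R (g \<otimes> h) = R g * R h" if gh: "g \<in> carrier G" "h \<in> carrier G" for g h
  proof (rule eq_matI)
    fix i j assume "i < dim_row (R g * R h)" "j < dim_col (R g * R h)"
    hence ij: "i < N" "j < N" by (auto simp: R_def)
    obtain k where k: "k < N" "e k = h \<otimes> e j" using surj[of "h \<otimes> e j"] gh ec ij by auto
    have "(R g * R h) $$ (i,j) = (\<Sum>l\<in>{0..<N}. (if e i = g \<otimes> e l then 1 else 0) * (if e l = e k then 1 else 0))"
      using ij k by (auto simp: R_def scalar_prod_def intro!: sum.cong)
    also have "\<dots> = (\<Sum>l\<in>{0..<N}. if l = k then (if e i = g \<otimes> e k then 1 else 0) else 0)"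
      using k(1) by (intro sum.cong) (auto simp: inj)
    also have "\<dots> = R (g \<otimes> h) $$ (i,j)" using k ij gh ec by (simp add: R_def m_assoc)
    finally show "R (g \<otimes> h) $$ (i,j) = (R g * R h) $$ (i,j)" by simp
  qed (auto simp: R_def)
  moreover have "R \<one> = 1\<^sub>m N" using ec inj by (intro eq_matI) (auto simp: R_def)
  ultimately have "is_rep G N R" by (auto simp: is_rep_def R_def)
  moreover have "g = \<one>" if g: "g \<in> carrier G" "R g = 1\<^sub>m N" for g
  proof -
    obtain j where j: "j < N" "e j = \<one>" using surj[of \<one>] by auto
    have "R g $$ (j,j) = 1" using g j by simp
    hence "e j = g \<otimes> e j" using j by (simp add: R_def split: if_splits)
    thus ?thesis using j g by simp
  qed
  ultimately show ?thesis by blast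
qed

text \<open>The condition that z fixes no nonzero vector is inherited by subrepresentations, whereas
  mere nontriviality of z is not. A representation of least positive dimension with this condition
  is therefore irreducible.\<close>

lemma (in group) exists_irr_rep_nontrivial_on_central:
  assumes fin: "finite (carrier G)" and z: "z \<in> carrier G" "z \<noteq> \<one>"
    and central: "\<And>g. g \<in> carrier G \<Longrightarrow> z \<otimes> g = g \<otimes> z"
  shows "\<exists>n \<rho>. irr_rep G n \<rho> \<and> \<rho> z \<noteq> 1\<^sub>m n"
proof -
  define P where "P d \<longleftrightarrow> d > 0 \<and>
    (\<exists>\<sigma>. is_rep G d \<sigma> \<and> (\<forall>v\<in>carrier_vec d. \<sigma> z *\<^sub>v v = v \<longrightarrow> v = 0\<^sub>v d))" for d
  obtain n0 \<rho>0 where r0: "is_rep G n0 \<rho>0" "\<rho>0 z \<noteq> 1\<^sub>m n0" using exists_faithful_rep[OF fin] z by blast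
  interpret r0: finite_rep G n0 \<rho>0 using fin r0 by unfold_locales
  have "\<exists>d. P d"
    using r0.exists_rep_without_fixed_vectors[OF z(1) r0(2)] central z
    unfolding P_def by (metis r0.rho_mult)
  define n where "n = Least P"
  have "P n" unfolding n_def using \<open>\<exists>d. P d\<close> by (rule LeastI_ex)
  then obtain \<rho> where n: "n > 0" and r: "is_rep G n \<rho>" and nf: "\<forall>v\<in>carrier_vec n. \<rho> z *\<^sub>v v = v \<longrightarrow> v = 0\<^sub>v n"
    unfolding P_def by blast
  interpret r: finite_rep G n \<rho> using fin r by unfold_locales
  have "W = {0\<^sub>v n} \<or> W = carrier_vec n" if W: "invariant_subspace G n \<rho> W" for W
  proof (rule ccontr)
    assume ne: "\<not> (W = {0\<^sub>v n} \<or> W = carrier_vec n)"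
    obtain d B C where sub: "B \<in> carrier_mat n d" "C \<in> carrier_mat d n" "C * B = 1\<^sub>m d"
      "is_rep G d (\<lambda>g. C * \<rho> g * B)"
      "\<forall>g\<in>carrier G. \<forall>x\<in>carrier_vec d. B *\<^sub>v ((C * \<rho> g * B) *\<^sub>v x) = \<rho> g *\<^sub>v (B *\<^sub>v x)"
      "\<forall>x\<in>carrier_vec d. B *\<^sub>v x \<in> W"
      "W \<noteq> {0\<^sub>v n} \<longrightarrow> d > 0" "W \<noteq> carrier_vec n \<longrightarrow> d < n"
      by (rule r.subrep[OF W])
    have "x = 0\<^sub>v d" if x: "x \<in> carrier_vec d" "(C * \<rho> z * B) *\<^sub>v x = x" for x
    proof -
      have "\<rho> z *\<^sub>v (B *\<^sub>v x) = B *\<^sub>v x" using sub(5)[rule_format, OF z(1) x(1)] x by simp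
      hence "B *\<^sub>v x = 0\<^sub>v n" using nf mult_mat_vec_carrier[OF sub(1) x(1)] by blast
      moreover have "C *\<^sub>v (B *\<^sub>v x) = x" using assoc_mult_mat_vec[OF sub(2,1) x(1)] sub(3) x by simp
      moreover have "C *\<^sub>v 0\<^sub>v n = 0\<^sub>v d" using sub(2) by (intro eq_vecI) auto
      ultimately show ?thesis by simp
    qed
    hence "P d" unfolding P_def using sub(4,7) ne by blast
    thus False using sub(8) ne not_less_Least[of d P] unfolding n_def by blast
  qed
  hence "irr_rep G n \<rho>" using n r by (simp add: irr_rep_def)
  moreover have "\<rho> z \<noteq> 1\<^sub>m n"
  proof
    assume "\<rho> z = 1\<^sub>m n"
    hence "unit_vec n 0 = (0\<^sub>v n :: complex vec)" using nf by auto
    thus False using n by (metis index_unit_vec(2) index_zero_vec(1) zero_neq_one)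
  qed
  ultimately show ?thesis by blast
qed

section \<open>Commutators and the lower central series\<close>

context group
begin

lemma FactGroup_hom: "N \<lhd> G \<Longrightarrow> group_hom G (G Mod N) (\<lambda>x. N #> x)"
  by (simp add: group_hom_def group_hom_axioms_def is_group normal.factorgroup_is_group
      normal.r_coset_hom_Mod)

lemma coset_eq_iff:
  assumes N: "N \<lhd> G" and xy: "x \<in> carrier G" "y \<in> carrier G"
  shows "N #> x = N #> y \<longleftrightarrow> x \<otimes> inv y \<in> N"
proof -
  interpret normal N G by (rule N)
  show ?thesis
  proof
    assume "N #> x = N #> y"
    hence "x \<in> N #> y" using rcos_self[OF xy(1) normal_imp_subgroup[OF N]] by simp
    thus "x \<otimes> inv y \<in> N" using xy rcos_module[OF is_group xy(2,1)] by simp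
  next
    assume "x \<otimes> inv y \<in> N"
    hence "x \<in> N #> y" using xy rcos_module[OF is_group xy(2,1)] by simp
    thus "N #> x = N #> y" using repr_independence[OF _ xy(2)] subgroup_axioms by auto
  qed
qed

lemma coset_eq_self_iff:
  assumes N: "N \<lhd> G" and x: "x \<in> carrier G"
  shows "N #> x = N \<longleftrightarrow> x \<in> N"
  using coset_eq_iff[OF N x one_closed] x coset_mult_one[of N] normal_imp_subgroup[OF N]
    subgroup.subset by fastforce

definition commutator :: "'a \<Rightarrow> 'a \<Rightarrow> 'a" where
  "commutator x y = x \<otimes> y \<otimes> inv x \<otimes> inv y"

lemma commutator_closed [simp]: "x \<in> carrier G \<Longrightarrow> y \<in> carrier G \<Longrightarrow> commutator x y \<in> carrier G"
  by (simp add: commutator_def)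

lemma commutator_mult_inv: "x \<in> carrier G \<Longrightarrow> y \<in> carrier G \<Longrightarrow> commutator x y = (x \<otimes> y) \<otimes> inv (y \<otimes> x)"
  by (simp add: commutator_def inv_mult_group m_assoc)

lemma commutator_mult_swap: "x \<in> carrier G \<Longrightarrow> y \<in> carrier G \<Longrightarrow> x \<otimes> y = commutator x y \<otimes> (y \<otimes> x)"
  by (simp add: commutator_mult_inv m_assoc)

lemma conj_commutator:
  assumes "x \<in> carrier G" "y \<in> carrier G" "g \<in> carrier G"
  shows "g \<otimes> commutator x y \<otimes> inv g = commutator (g \<otimes> x \<otimes> inv g) (g \<otimes> y \<otimes> inv g)"
proof -
  have "inv g \<otimes> (g \<otimes> u) = u" if "u \<in> carrier G" for u
    using assms that by (simp add: m_assoc[symmetric])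
  thus ?thesis using assms by (simp add: commutator_def inv_mult_group m_assoc)
qed

lemma commutator_mult_left:
  assumes "x \<in> carrier G" "y \<in> carrier G" "g \<in> carrier G"
  shows "commutator (x \<otimes> y) g = (x \<otimes> commutator y g \<otimes> inv x) \<otimes> commutator x g"
proof -
  have c: "inv x \<otimes> (x \<otimes> u) = u" "inv g \<otimes> (g \<otimes> u) = u" if "u \<in> carrier G" for u
    using assms that by (simp_all add: m_assoc[symmetric])
  show ?thesis using assms by (simp add: commutator_def inv_mult_group m_assoc c)
qed

lemma commutator_inv_left:
  assumes "x \<in> carrier G" "g \<in> carrier G"
  shows "commutator (inv x) g = inv x \<otimes> inv (commutator x g) \<otimes> inv (inv x)"
proof -
  have c: "inv x \<otimes> (x \<otimes> u) = u" if "u \<in> carrier G" for u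
    using assms that by (simp_all add: m_assoc[symmetric])
  show ?thesis using assms by (simp add: commutator_def inv_mult_group m_assoc c)
qed

text \<open>For normal N this is the preimage in G of the center of G/N, kept inside G so that it
  can be compared with terms of the lower central series.\<close>

definition central_mod :: "'a set \<Rightarrow> 'a set" where
  "central_mod N = {x \<in> carrier G. \<forall>y\<in>carrier G. commutator x y \<in> N}"

lemma central_mod_normal:
  assumes N: "N \<lhd> G"
  shows "central_mod N \<lhd> G"
proof -
  interpret N: normal N G by (rule N)
  show ?thesis
    unfolding normal_inv_iff
  proof (intro conjI ballI)
    show "subgroup (central_mod N) G"
    proof (rule subgroupI)
      have "\<one> \<in> central_mod N" by (simp add: central_mod_def commutator_def)
      thus "central_mod N \<noteq> {}" by blast
      show "inv a \<in> central_mod N" if "a \<in> central_mod N" for a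
        using that N.inv_op_closed2[of "inv a"]
        by (auto simp: central_mod_def commutator_inv_left)
      show "a \<otimes> b \<in> central_mod N" if "a \<in> central_mod N" "b \<in> central_mod N" for a b
        using that N.inv_op_closed2[of a] by (auto simp: central_mod_def commutator_mult_left)
    qed (auto simp: central_mod_def)
    fix x h assume x: "x \<in> carrier G" and h: "h \<in> central_mod N"
    have "commutator (x \<otimes> h \<otimes> inv x) y \<in> N" if y: "y \<in> carrier G" for y
    proof -
      have hc: "h \<in> carrier G" using h by (simp add: central_mod_def)
      have "x \<otimes> (inv x \<otimes> y \<otimes> x) \<otimes> inv x = y" using x y
        by (metis inv_closed inv_solve_right' m_assoc m_closed r_inv l_one)
      hence "commutator (x \<otimes> h \<otimes> inv x) y = x \<otimes> commutator h (inv x \<otimes> y \<otimes> x) \<otimes> inv x"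
        using conj_commutator[of h "inv x \<otimes> y \<otimes> x" x] x y hc by simp
      thus ?thesis using h x y N.inv_op_closed2 by (simp add: central_mod_def)
    qed
    thus "x \<otimes> h \<otimes> inv x \<in> central_mod N" using x h by (simp add: central_mod_def)
  qed
qed

lemma normal_subset_central_mod:
  assumes N: "N \<lhd> G"
  shows "N \<subseteq> central_mod N"
proof
  interpret N: normal N G by (rule N)
  fix x assume x: "x \<in> N"
  have "commutator x y \<in> N" if y: "y \<in> carrier G" for y
  proof -
    have "commutator x y = x \<otimes> (y \<otimes> inv x \<otimes> inv y)" using x y by (simp add: commutator_def m_assoc)
    thus ?thesis using x y N.inv_op_closed2[OF y N.m_inv_closed[OF x]] by simp
  qed
  thus "x \<in> central_mod N" using x by (simp add: central_mod_def)
qed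

text \<open>Here w is the commutator of x and y: each of the k factors x leaves one w behind when it
  passes y, and the w can be collected in front.\<close>

lemma pow_swap:
  assumes xyw: "x \<in> carrier G" "y \<in> carrier G" "w \<in> carrier G"
    and eq: "x \<otimes> y = w \<otimes> (y \<otimes> x)" and comm: "w \<otimes> x = x \<otimes> w"
  shows "x [^] (k::nat) \<otimes> y = w [^] k \<otimes> (y \<otimes> x [^] k)"
proof (induction k)
  case 0 show ?case using xyw by simp
next
  case (Suc k)
  have "x [^] Suc k \<otimes> y = x [^] k \<otimes> (x \<otimes> y)" using xyw by (simp add: m_assoc)
  also have "\<dots> = (x [^] k \<otimes> w) \<otimes> (y \<otimes> x)" unfolding eq using xyw by (simp add: m_assoc)
  also have "x [^] k \<otimes> w = w \<otimes> x [^] k"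
    using xyw comm by (metis group_commutes_pow)
  also have "(w \<otimes> x [^] k) \<otimes> (y \<otimes> x) = w \<otimes> (x [^] k \<otimes> y) \<otimes> x" using xyw by (simp add: m_assoc)
  also have "\<dots> = w [^] Suc k \<otimes> (y \<otimes> x [^] Suc k)"
    unfolding Suc using xyw by (simp only: nat_pow_Suc2[of w]) (simp add: m_assoc)
  finally show ?case .
qed

text \<open>Modulo \<open>N\<close> the commutator with \<open>y\<close> is a homomorphism on the powers of \<open>x\<close>.\<close>

lemma commutator_pow_mem_iff:
  assumes N: "N \<lhd> G" and xy: "x \<in> carrier G" "y \<in> carrier G"
    and c: "commutator x y \<in> central_mod N"
  shows "commutator (x [^] (k::nat)) y \<in> N \<longleftrightarrow> commutator x y [^] k \<in> N"
proof -
  interpret h: group_hom G "G Mod N" "\<lambda>x. N #> x" by (rule FactGroup_hom[OF N])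
  have comm: "(N #> u) \<otimes>\<^bsub>G Mod N\<^esub> (N #> v) = (N #> v) \<otimes>\<^bsub>G Mod N\<^esub> (N #> u)"
    if "commutator u v \<in> N" "u \<in> carrier G" "v \<in> carrier G" for u v
    using that coset_eq_iff[OF N, of "u \<otimes> v" "v \<otimes> u"] h.hom_mult[of u v] h.hom_mult[of v u]
    by (simp add: commutator_mult_inv)
  let ?X = "N #> x" and ?Y = "N #> y" and ?W = "N #> commutator x y"
  have "?X \<otimes>\<^bsub>G Mod N\<^esub> ?Y = ?W \<otimes>\<^bsub>G Mod N\<^esub> (?Y \<otimes>\<^bsub>G Mod N\<^esub> ?X)"
    using arg_cong[OF commutator_mult_swap[OF xy], of "\<lambda>u. N #> u"] xy
    by (simp only: h.hom_mult commutator_closed m_closed)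
  moreover have "?W \<otimes>\<^bsub>G Mod N\<^esub> ?X = ?X \<otimes>\<^bsub>G Mod N\<^esub> ?W"
    using c xy by (intro comm) (auto simp: central_mod_def)
  ultimately have "?X [^]\<^bsub>G Mod N\<^esub> k \<otimes>\<^bsub>G Mod N\<^esub> ?Y = ?W [^]\<^bsub>G Mod N\<^esub> k \<otimes>\<^bsub>G Mod N\<^esub> (?Y \<otimes>\<^bsub>G Mod N\<^esub> ?X [^]\<^bsub>G Mod N\<^esub> k)"
    using xy h.hom_closed by (intro h.H.pow_swap) auto
  hence "N #> (x [^] k \<otimes> y) = N #> (commutator x y [^] k \<otimes> (y \<otimes> x [^] k))"
    using xy by (simp only: h.hom_mult h.hom_nat_pow[symmetric] commutator_closed m_closed nat_pow_closed)
  moreover have "N #> (x [^] k \<otimes> y) = N #> (commutator (x [^] k) y \<otimes> (y \<otimes> x [^] k))"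
    using commutator_mult_swap[of "x [^] k" y] xy by simp
  ultimately have "(N #> commutator (x [^] k) y) \<otimes>\<^bsub>G Mod N\<^esub> (N #> (y \<otimes> x [^] k))
      = (N #> (commutator x y [^] k)) \<otimes>\<^bsub>G Mod N\<^esub> (N #> (y \<otimes> x [^] k))"
    using xy by (simp only: h.hom_mult[symmetric] commutator_closed m_closed nat_pow_closed)
  hence "N #> commutator (x [^] k) y = N #> (commutator x y [^] k)"
    using xy by (rule_tac iffD1[OF h.H.right_cancel[of "N #> (y \<otimes> x [^] k)"]])
      (simp_all only: h.hom_closed commutator_closed m_closed nat_pow_closed)
  thus ?thesis
    using coset_eq_self_iff[OF N, of "commutator (x [^] k) y"]
      coset_eq_self_iff[OF N, of "commutator x y [^] k"] xy by simp
qed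

lemma lower_central_Suc:
  "lower_central G (Suc i) = generate G {commutator x y | x y. x \<in> lower_central G i \<and> y \<in> carrier G}"
  by (simp add: commutator_def)

lemma lower_central_normal: "lower_central G i \<lhd> G"
proof (induction i)
  case 0 show ?case by (simp add: normal_self)
next
  case (Suc i)
  interpret N: normal "lower_central G i" G by (rule Suc)
  show ?case
    unfolding lower_central_Suc
  proof (rule normal_generateI)
    fix h g assume "h \<in> {commutator x y | x y. x \<in> lower_central G i \<and> y \<in> carrier G}" and g: "g \<in> carrier G"
    then obtain x y where xy: "x \<in> lower_central G i" "y \<in> carrier G" "h = commutator x y" by auto
    have "g \<otimes> h \<otimes> inv g = commutator (g \<otimes> x \<otimes> inv g) (g \<otimes> y \<otimes> inv g)"
      using xy g by (simp add: conj_commutator)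
    moreover have "g \<otimes> x \<otimes> inv g \<in> lower_central G i" using xy g N.inv_op_closed2 by simp
    ultimately show "g \<otimes> h \<otimes> inv g \<in> {commutator x y | x y. x \<in> lower_central G i \<and> y \<in> carrier G}"
      using xy(2) g by (metis (mono_tags, lifting) mem_Collect_eq inv_closed m_closed)
  qed auto
qed

lemma lower_central_subgroup: "subgroup (lower_central G i) G"
  by (rule normal_imp_subgroup[OF lower_central_normal])

lemma lower_central_closed: "x \<in> lower_central G i \<Longrightarrow> x \<in> carrier G"
  by (rule subgroup.mem_carrier[OF lower_central_subgroup])

lemma lower_central_SucI:
  "x \<in> lower_central G i \<Longrightarrow> y \<in> carrier G \<Longrightarrow> commutator x y \<in> lower_central G (Suc i)"
  unfolding lower_central_Suc by (rule generate.incl) blast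

lemma lower_central_Suc_least:
  assumes "subgroup M G" "\<And>x y. x \<in> lower_central G i \<Longrightarrow> y \<in> carrier G \<Longrightarrow> commutator x y \<in> M"
  shows "lower_central G (Suc i) \<subseteq> M"
  unfolding lower_central_Suc using assms by (intro generate_subgroup_incl) auto

lemma lower_central_subset_central_mod: "lower_central G i \<subseteq> central_mod (lower_central G (Suc i))"
  using lower_central_SucI lower_central_closed by (auto simp: central_mod_def simp del: lower_central.simps)

lemma lower_central_Suc_subset: "lower_central G (Suc i) \<subseteq> lower_central G i"
proof (rule lower_central_Suc_least[OF lower_central_subgroup])
  fix x y assume "x \<in> lower_central G i" "y \<in> carrier G"
  thus "commutator x y \<in> lower_central G i"
    using normal_subset_central_mod[OF lower_central_normal[of i]] by (auto simp: central_mod_def)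
qed

lemma lower_central_antimono: "i \<le> j \<Longrightarrow> lower_central G j \<subseteq> lower_central G i"
  using lower_central_Suc_subset by (rule lift_Suc_antimono_le)

text \<open>Modulo term i+2 the p-th power of a generator [x,y] of term i+1 is [x^p,y], and x^p
  already lies in term i+1, so the power is trivial there. Term i+1 is central modulo term i+2, so
  p-th powers are multiplicative and the conclusion spreads from generators to all elements.\<close>

lemma lower_central_exponent_step:
  assumes exp: "\<And>x. x \<in> lower_central G i \<Longrightarrow> x [^] (p::nat) \<in> lower_central G (Suc i)"
    and x: "x \<in> lower_central G (Suc i)"
  shows "x [^] p \<in> lower_central G (Suc (Suc i))"
proof -
  define N where "N = lower_central G (Suc (Suc i))"
  define L where "L = lower_central G (Suc i)"
  have N: "N \<lhd> G" and L: "subgroup L G"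
    unfolding N_def L_def by (rule lower_central_normal lower_central_subgroup)+
  interpret h: group_hom G "G Mod N" "\<lambda>x. N #> x" by (rule FactGroup_hom[OF N])
  have Lc: "L \<subseteq> central_mod N" unfolding L_def N_def by (rule lower_central_subset_central_mod)
  define E where "E = {x \<in> L. x [^] p \<in> N}"
  have E: "x \<in> E \<longleftrightarrow> x \<in> L \<and> (N #> x) [^]\<^bsub>G Mod N\<^esub> p = \<one>\<^bsub>G Mod N\<^esub>" for x
    using coset_eq_self_iff[OF N, of "x [^] p"] subgroup.mem_carrier[OF L]
    by (auto simp: E_def h.hom_nat_pow[symmetric])
  have "subgroup E G"
  proof (rule subgroupI)
    show "E \<subseteq> carrier G" using subgroup.mem_carrier[OF L] by (auto simp: E_def)
    show "E \<noteq> {}" using subgroup.one_closed[OF L] subgroup.one_closed[OF normal_imp_subgroup[OF N]]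
      by (auto simp: E_def intro!: exI[of _ \<one>])
    fix a assume a: "a \<in> E"
    have ac: "a \<in> carrier G" "a \<in> L" using a subgroup.mem_carrier[OF L] by (auto simp: E_def)
    have "inv (a [^] p) \<in> N" using a subgroup.m_inv_closed[OF normal_imp_subgroup[OF N]] by (simp add: E_def)
    hence "inv a [^] p \<in> N" using ac by (simp add: nat_pow_inv)
    thus "inv a \<in> E" using ac subgroup.m_inv_closed[OF L] by (simp add: E_def)
    fix b assume b: "b \<in> E"
    have bc: "b \<in> carrier G" "b \<in> L" using b subgroup.mem_carrier[OF L] by (auto simp: E_def)
    have "commutator a b \<in> N" using ac bc Lc by (auto simp: central_mod_def)
    hence "(N #> a) \<otimes>\<^bsub>G Mod N\<^esub> (N #> b) = (N #> b) \<otimes>\<^bsub>G Mod N\<^esub> (N #> a)"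
      using ac bc coset_eq_iff[OF N, of "a \<otimes> b" "b \<otimes> a"] h.hom_mult[of a b] h.hom_mult[of b a]
      by (simp add: commutator_mult_inv)
    hence "(N #> (a \<otimes> b)) [^]\<^bsub>G Mod N\<^esub> p = (N #> a) [^]\<^bsub>G Mod N\<^esub> p \<otimes>\<^bsub>G Mod N\<^esub> (N #> b) [^]\<^bsub>G Mod N\<^esub> p"
      using ac bc h.hom_closed h.H.pow_mult_distrib by (simp only: h.hom_mult)
    thus "a \<otimes> b \<in> E" using a b ac bc subgroup.m_closed[OF L] unfolding E by (metis h.H.l_one h.H.one_closed)
  qed
  hence "L \<subseteq> E" unfolding L_def
  proof (rule lower_central_Suc_least)
    fix x y assume xy: "x \<in> lower_central G i" "y \<in> carrier G"
    have xc: "x \<in> carrier G" using lower_central_closed[OF xy(1)] .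
    have c: "commutator x y \<in> L" unfolding L_def by (rule lower_central_SucI[OF xy])
    have "commutator (x [^] p) y \<in> N" unfolding N_def by (rule lower_central_SucI[OF exp[OF xy(1)] xy(2)])
    hence "commutator x y [^] p \<in> N"
      using commutator_pow_mem_iff[OF N xc xy(2)] c Lc by blast
    thus "commutator x y \<in> E" using c by (simp add: E_def)
  qed
  thus ?thesis using x by (auto simp: E_def L_def N_def simp del: lower_central.simps)
qed

end

lemma (in group_hom) hom_commutator:
  assumes "x \<in> carrier G" "y \<in> carrier G"
  shows "h (G.commutator x y) = H.commutator (h x) (h y)"
  using assms by (simp add: G.commutator_def H.commutator_def)

lemma (in group_hom) lower_central_image:
  assumes surj: "h ` carrier G = carrier H"
  shows "lower_central H i = h ` lower_central G i"
proof (induction i)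
  case 0 show ?case using surj by simp
next
  case (Suc i)
  let ?S = "{G.commutator x y | x y. x \<in> lower_central G i \<and> y \<in> carrier G}"
  have "{H.commutator x y | x y. x \<in> lower_central H i \<and> y \<in> carrier H} = h ` ?S" (is "?T = _")
  proof (intro equalityI subsetI)
    fix u assume "u \<in> ?T"
    then obtain x y where xy: "x \<in> lower_central G i" "y \<in> carrier G" "u = H.commutator (h x) (h y)"
      unfolding Suc surj[symmetric] by blast
    hence "u = h (G.commutator x y)" using hom_commutator[OF G.lower_central_closed] by simp
    thus "u \<in> h ` ?S" using xy by blast
  next
    fix u assume "u \<in> h ` ?S"
    then obtain x y where xy: "x \<in> lower_central G i" "y \<in> carrier G" "u = h (G.commutator x y)" by blast
    hence "u = H.commutator (h x) (h y)" using hom_commutator[OF G.lower_central_closed] by simp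
    thus "u \<in> ?T" using xy hom_closed unfolding Suc by blast
  qed
  moreover have "?S \<subseteq> carrier G" using G.lower_central_closed by auto
  ultimately show ?case unfolding H.lower_central_Suc G.lower_central_Suc by (simp add: generate_img)
qed

section \<open>Finite p-groups and their nilpotency\<close>

locale p_group = group G for G (structure) +
  fixes p :: nat
  assumes prime: "Factorial_Ring.prime p" and card_pow: "\<exists>k. card (carrier G) = p ^ k"
begin

lemma p_gt_1: "p > 1"
  using prime by (rule prime_gt_1_nat)

lemma p_group_finite: "finite (carrier G)"
  using card_pow p_gt_1 by (metis card.infinite power_eq_0_iff not_one_less_zero)

lemma card_subgroup_pow:
  assumes "subgroup H G"
  obtains k where "card H = p ^ k"
proof -
  have "card H dvd card (carrier G)" using lagrange[OF assms] by (metis dvd_triv_right order_def)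
  thus thesis using that card_pow divides_primepow_nat[OF prime] by metis
qed

lemma card_strict_subgroup:
  assumes H: "subgroup H G" and K: "subgroup K G" and "H \<subset> K"
  shows "p * card H \<le> card K"
proof -
  obtain i j where ij: "card H = p ^ i" "card K = p ^ j"
    using card_subgroup_pow[OF H] card_subgroup_pow[OF K] by metis
  have "finite K" by (rule finite_subset[OF subgroup.subset[OF K] p_group_finite])
  hence "card H < card K" using assms(3) by (rule psubset_card_mono)
  hence "i < j" using ij p_gt_1 by simp
  hence "p ^ Suc i \<le> p ^ j" using p_gt_1 by (intro power_increasing) auto
  thus ?thesis using ij by simp
qed

text \<open>Orbit counting: the conjugacy classes in \<open>N\<close> have \<open>p\<close>-power size and the trivial one has size 1,
  so \<open>p dvd card N\<close> forces another class of size 1.\<close>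

lemma normal_meets_center:
  assumes N: "N \<lhd> G" and ne: "N \<noteq> {\<one>}"
  obtains z where "z \<in> N" "z \<noteq> \<one>" "\<And>g. g \<in> carrier G \<Longrightarrow> z \<otimes> g = g \<otimes> z"
proof (rule ccontr)
  assume "\<not> thesis"
  with that have nc: "\<And>z. z \<in> N \<Longrightarrow> z \<noteq> \<one> \<Longrightarrow> \<exists>g\<in>carrier G. z \<otimes> g \<noteq> g \<otimes> z" by blast
  interpret N: normal N G by (rule N)
  define \<phi> where "\<phi> = (\<lambda>g. \<lambda>h\<in>carrier G. g \<otimes> h \<otimes> inv g)"
  interpret act: group_action G "carrier G" \<phi> unfolding \<phi>_def by (rule action_by_conjugation)
  define C where "C = orbit G \<phi> ` (N - {\<one>})"
  have orb: "orbit G \<phi> x = {g \<otimes> x \<otimes> inv g | g. g \<in> carrier G}" if "x \<in> carrier G" for x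
    using that by (auto simp: orbit_def \<phi>_def)
  have sub: "orbit G \<phi> x \<subseteq> N - {\<one>}" if x: "x \<in> N - {\<one>}" for x
  proof
    fix y assume "y \<in> orbit G \<phi> x"
    then obtain g where g: "g \<in> carrier G" "y = g \<otimes> x \<otimes> inv g" using orb x by auto
    have "y \<noteq> \<one>"
    proof
      assume "y = \<one>"
      hence "g \<otimes> x = g" using g x by (metis DiffD1 N.mem_carrier inv_closed inv_equality inv_inv m_closed)
      thus False using g x by simp
    qed
    thus "y \<in> N - {\<one>}" using g x N.inv_op_closed2 by auto
  qed
  have Un: "\<Union>C = N - {\<one>}"
  proof
    show "\<Union>C \<subseteq> N - {\<one>}" unfolding C_def using sub by blast
    show "N - {\<one>} \<subseteq> \<Union>C"
    proof
      fix x assume x: "x \<in> N - {\<one>}"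
      hence "x \<in> orbit G \<phi> x" by (intro act.orbit_refl) simp
      thus "x \<in> \<Union>C" unfolding C_def using x by blast
    qed
  qed
  have finN: "finite N" by (rule finite_subset[OF N.subset p_group_finite])
  have "p dvd card (\<Union>C)"
  proof (rule dvd_partition)
    show "finite (\<Union>C)" using Un finN by simp
    show "\<forall>c\<in>C. p dvd card c"
    proof
      fix c assume "c \<in> C"
      then obtain x where x: "x \<in> N" "x \<noteq> \<one>" "c = orbit G \<phi> x" by (auto simp: C_def)
      have xc: "x \<in> carrier G" using x by simp
      have "card c dvd card (carrier G)"
        using act.orbit_stabilizer_theorem[OF xc] x by (metis dvd_triv_left order_def)
      then obtain j where j: "card c = p ^ j" using card_pow divides_primepow_nat[OF prime] by metis
      have "j \<noteq> 0"
      proof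
        assume "j = 0"
        hence "card c = 1" using j by simp
        then obtain y where y: "c = {y}" using card_1_singletonE by blast
        have "x \<in> c" using act.orbit_refl[OF xc] x by simp
        hence cx: "c = {x}" using y by simp
        have "x \<otimes> g = g \<otimes> x" if g: "g \<in> carrier G" for g
        proof -
          have "g \<otimes> x \<otimes> inv g \<in> c" using x orb[OF xc] g by blast
          hence "g \<otimes> x \<otimes> inv g = x" using cx by simp
          thus ?thesis using g xc by (metis inv_solve_right' m_closed)
        qed
        thus False using nc x by blast
      qed
      thus "p dvd card c" using j by simp
    qed
    show "\<forall>c1\<in>C. \<forall>c2\<in>C. c1 \<noteq> c2 \<longrightarrow> c1 \<inter> c2 = {}"
    proof (intro ballI impI, rule ccontr)
      fix c1 c2 assume c: "c1 \<in> C" "c2 \<in> C" "c1 \<noteq> c2" "c1 \<inter> c2 \<noteq> {}"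
      have "C \<subseteq> orbits G (carrier G) \<phi>" by (auto simp: C_def orbits_def)
      thus False using c act.disjoint_union by blast
    qed
  qed
  moreover have "p dvd card N"
  proof -
    obtain k where k: "card N = p ^ k" using card_subgroup_pow[OF N.subgroup_axioms] by blast
    have "k \<noteq> 0"
    proof
      assume "k = 0"
      hence "card N = 1" using k by simp
      then obtain y where "N = {y}" using card_1_singletonE by blast
      thus False using ne N.one_closed by auto
    qed
    thus ?thesis using k by simp
  qed
  moreover have "card N = Suc (card (N - {\<one>}))"
    by (rule card.remove[OF finN N.one_closed])
  ultimately have "p dvd 1" unfolding Un by (metis One_nat_def dvd_add_right_iff plus_1_eq_Suc add.commute Suc_eq_plus1)
  thus False using p_gt_1 by simp
qed

lemma FactGroup_p_group:
  assumes N: "N \<lhd> G"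
  shows "p_group (G Mod N) p"
proof -
  interpret N: normal N G by (rule N)
  have "card (carrier (G Mod N)) * card N = card (carrier G)"
    using lagrange[OF N.subgroup_axioms] by (simp add: FactGroup_def order_def)
  hence "card (carrier (G Mod N)) dvd card (carrier G)" by (metis dvd_triv_left)
  hence "\<exists>k. card (carrier (G Mod N)) = p ^ k" using card_pow divides_primepow_nat[OF prime] by metis
  thus ?thesis
    using prime N.factorgroup_is_group by (simp add: p_group_def p_group_axioms_def)
qed

text \<open>A nontrivial central element of the nontrivial p-group G/N is pulled back to G.\<close>

lemma central_mod_psupset:
  assumes N: "N \<lhd> G" and ne: "N \<noteq> carrier G"
  shows "N \<subset> central_mod N"
proof -
  interpret N: normal N G by (rule N)
  interpret h: group_hom G "G Mod N" "\<lambda>x. N #> x" by (rule FactGroup_hom[OF N])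
  interpret Q: p_group "G Mod N" p by (rule FactGroup_p_group[OF N])
  obtain g where g: "g \<in> carrier G" "g \<notin> N" using ne N.subset by blast
  have "N #> g \<noteq> N" using coset_eq_self_iff[OF N g(1)] g by simp
  hence "carrier (G Mod N) \<noteq> {\<one>\<^bsub>G Mod N\<^esub>}" using h.hom_closed[OF g(1)] by auto
  then obtain Z where Z: "Z \<in> carrier (G Mod N)" "Z \<noteq> \<one>\<^bsub>G Mod N\<^esub>"
    "\<And>g. g \<in> carrier (G Mod N) \<Longrightarrow> Z \<otimes>\<^bsub>G Mod N\<^esub> g = g \<otimes>\<^bsub>G Mod N\<^esub> Z"
    using Q.normal_meets_center[OF h.H.normal_self] by blast
  obtain z where z: "z \<in> carrier G" "Z = N #> z" using Z(1) by (auto simp: carrier_FactGroup)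
  have "z \<notin> N" using Z(2) coset_eq_self_iff[OF N z(1)] z by simp
  moreover have "z \<in> central_mod N"
  proof -
    have "commutator z y \<in> N" if y: "y \<in> carrier G" for y
    proof -
      have "N #> (z \<otimes> y) = N #> (y \<otimes> z)"
        using Z(3)[OF h.hom_closed[OF y]] z y by (simp only: h.hom_mult)
      thus ?thesis using coset_eq_iff[OF N, of "z \<otimes> y" "y \<otimes> z"] z y by (simp add: commutator_mult_inv)
    qed
    thus ?thesis using z by (simp add: central_mod_def)
  qed
  ultimately show ?thesis using normal_subset_central_mod[OF N] by blast
qed

text \<open>Climbing the upper central series above N: one further commutator takes
  \<open>central_mod N\<close> into N, and the index drops in each round. The case of trivial N is
  nilpotency.\<close>

lemma lower_central_eventually_subset:
  assumes "N \<lhd> G"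
  shows "\<exists>c. lower_central G c \<subseteq> N"
  using assms
proof (induction "card (carrier G) - card N" arbitrary: N rule: less_induct)
  case less
  note N = less.prems
  show ?case
  proof (cases "N = carrier G")
    case True
    thus ?thesis by (intro exI[of _ 0]) simp
  next
    case False
    have sub: "central_mod N \<subseteq> carrier G" by (auto simp: central_mod_def)
    have ps: "N \<subset> central_mod N" by (rule central_mod_psupset[OF N False])
    have "card N < card (central_mod N)"
      by (rule psubset_card_mono[OF finite_subset[OF sub p_group_finite] ps])
    moreover have "card (central_mod N) \<le> card (carrier G)" by (rule card_mono[OF p_group_finite sub])
    ultimately have "\<exists>c. lower_central G c \<subseteq> central_mod N"
      using less.hyps[OF _ central_mod_normal[OF N]] by simp
    then obtain c where c: "lower_central G c \<subseteq> central_mod N" by blast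
    have "lower_central G (Suc c) \<subseteq> N"
      using c by (intro lower_central_Suc_least normal_imp_subgroup[OF N]) (auto simp: central_mod_def)
    thus ?thesis by blast
  qed
qed

text \<open>Each term determines the next, so a repeated term would repeat forever, against
  nilpotency.\<close>

lemma lower_central_strict:
  assumes "lower_central G i \<noteq> {\<one>}"
  shows "lower_central G (Suc i) \<subset> lower_central G i"
proof (rule ccontr)
  assume "\<not> lower_central G (Suc i) \<subset> lower_central G i"
  hence eq: "lower_central G (Suc i) = lower_central G i" using lower_central_Suc_subset by blast
  have const: "lower_central G (i + k) = lower_central G i" for k
  proof (induction k)
    case (Suc k)
    have "lower_central G (i + Suc k) = lower_central G (Suc i)"
      unfolding add_Suc_right lower_central_Suc Suc ..
    thus ?case using eq by simp
  qed simp
  obtain c where "lower_central G c \<subseteq> {\<one>}" using lower_central_eventually_subset[OF one_is_normal] by blast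
  hence "lower_central G (i + c) \<subseteq> {\<one>}" using lower_central_antimono[of c "i + c"] by auto
  thus False using assms const[of c] subgroup.one_closed[OF lower_central_subgroup[of i]] by auto
qed

lemma card_lower_central_Suc:
  assumes "lower_central G i \<noteq> {\<one>}"
  shows "p * card (lower_central G (Suc i)) \<le> card (lower_central G i)"
  by (rule card_strict_subgroup[OF lower_central_subgroup lower_central_subgroup lower_central_strict[OF assms]])

end

section \<open>Inflation of irreducible representations from quotients\<close>

lemma irr_rep_comp_hom:
  assumes h: "group_hom G H h" and surj: "h ` carrier G = carrier H" and irr: "irr_rep H n \<sigma>"
  shows "irr_rep G n (\<sigma> \<circ> h)"
proof -
  interpret h: group_hom G H h by (rule h)
  have "is_rep G n (\<sigma> \<circ> h)"
    using irr unfolding irr_rep_def is_rep_def by auto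
  moreover have "invariant_subspace G n (\<sigma> \<circ> h) W \<longleftrightarrow> invariant_subspace H n \<sigma> W" for W
    unfolding invariant_subspace_def surj[symmetric] by auto
  ultimately show ?thesis using irr unfolding irr_rep_def by auto
qed

text \<open>In G/N the coset of z is central and nontrivial; a suitable irreducible representation
  there is inflated to G.\<close>

lemma (in group) exists_irr_rep_mod:
  assumes fin: "finite (carrier G)" and N: "N \<lhd> G" and z: "z \<in> central_mod N" "z \<notin> N"
  shows "\<exists>n \<rho>. irr_rep G n \<rho> \<and> (\<forall>x\<in>N. \<rho> x = 1\<^sub>m n) \<and> \<rho> z \<noteq> 1\<^sub>m n"
proof -
  interpret N: normal N G by (rule N)
  interpret h: group_hom G "G Mod N" "\<lambda>x. N #> x" by (rule FactGroup_hom[OF N])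
  have zc: "z \<in> carrier G" using z by (simp add: central_mod_def)
  have "(N #> z) \<otimes>\<^bsub>G Mod N\<^esub> Y = Y \<otimes>\<^bsub>G Mod N\<^esub> (N #> z)" if Y: "Y \<in> carrier (G Mod N)" for Y
  proof -
    obtain y where y: "y \<in> carrier G" "Y = N #> y" using Y by (auto simp: carrier_FactGroup)
    have "N #> (z \<otimes> y) = N #> (y \<otimes> z)"
      using z y zc coset_eq_iff[OF N, of "z \<otimes> y" "y \<otimes> z"] by (simp add: central_mod_def commutator_mult_inv)
    thus ?thesis using y zc by (simp only: h.hom_mult)
  qed
  moreover have "finite (carrier (G Mod N))" using fin by (simp add: carrier_FactGroup)
  moreover have "N #> z \<noteq> \<one>\<^bsub>G Mod N\<^esub>" using coset_eq_self_iff[OF N zc] z by simp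
  ultimately obtain n \<sigma> where s: "irr_rep (G Mod N) n \<sigma>" "\<sigma> (N #> z) \<noteq> 1\<^sub>m n"
    using h.H.exists_irr_rep_nontrivial_on_central[of "N #> z"] h.hom_closed[OF zc] by blast
  have "irr_rep G n (\<sigma> \<circ> (\<lambda>x. N #> x))"
    using h.group_hom_axioms s(1) by (intro irr_rep_comp_hom) (auto simp: carrier_FactGroup)
  moreover have "(\<sigma> \<circ> (\<lambda>x. N #> x)) x = 1\<^sub>m n" if "x \<in> N" for x
  proof -
    have "N #> x = \<one>\<^bsub>G Mod N\<^esub>" using that coset_eq_self_iff[OF N, of x] by simp
    thus ?thesis using s(1) by (simp add: irr_rep_def is_rep_def)
  qed
  ultimately show ?thesis using s(2) by (intro exI[of _ n] exI[of _ "\<sigma> \<circ> (\<lambda>x. N #> x)"]) simp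
qed

section \<open>Codegrees\<close>

declare lower_central.simps(2) [simp del]

lemma (in group) finite_irr_repI:
  assumes "finite (carrier G)" "irr_rep G n \<rho>"
  shows "finite_irr_rep G n \<rho>"
  using assms by unfold_locales (auto simp: irr_rep_def)

lemma irr_rep_dim_one:
  assumes rep: "is_rep G 1 \<rho>"
  shows "irr_rep G 1 \<rho>"
  unfolding irr_rep_def
proof (intro conjI allI impI rep)
  fix W assume W: "invariant_subspace G 1 \<rho> W"
  show "W = {0\<^sub>v 1} \<or> W = carrier_vec 1"
  proof (cases "W \<subseteq> {0\<^sub>v 1}")
    case True thus ?thesis using W by (auto simp: invariant_subspace_def)
  next
    case False
    then obtain v where v: "v \<in> W" "v \<noteq> 0\<^sub>v 1" by blast
    have vc: "v \<in> carrier_vec 1" using v W by (auto simp: invariant_subspace_def)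
    have v0: "v $ 0 \<noteq> 0"
    proof
      assume "v $ 0 = 0"
      hence "v = 0\<^sub>v 1" using vc by (intro eq_vecI) auto
      thus False using v by simp
    qed
    have "w \<in> W" if w: "w \<in> carrier_vec 1" for w
    proof -
      have "w = (w $ 0 / v $ 0) \<cdot>\<^sub>v v" using w vc v0 by (intro eq_vecI) auto
      thus ?thesis using W v(1) unfolding invariant_subspace_def by metis
    qed
    thus ?thesis using W by (auto simp: invariant_subspace_def)
  qed
qed simp

lemma card_roots_of_unity_le:
  fixes T :: "complex set"
  assumes "m > 0" "\<And>t. t \<in> T \<Longrightarrow> t ^ m = 1"
  shows "card T \<le> m"
proof -
  have "card T \<le> card {z::complex. z ^ m = 1}"
    using assms by (intro card_mono finite_roots_unity) auto
  also have "\<dots> \<le> m" using card_roots_unity[of m] assms by simp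
  finally show ?thesis .
qed

text \<open>This says that every codegree is p^b with b in S, as an equation of natural numbers,
  free of complex division. Asking for an inclusion only, rather than for the exact set of
  codegrees, makes the property pass to quotients.\<close>

definition codegree_exponents_in :: "('a, 'b) monoid_scheme \<Rightarrow> nat \<Rightarrow> nat set \<Rightarrow> bool" where
  "codegree_exponents_in G p S \<longleftrightarrow> (\<forall>n \<rho>. irr_rep G n \<rho> \<longrightarrow>
     (\<exists>b\<in>S. card (carrier G) = card {g \<in> carrier G. \<rho> g = 1\<^sub>m n} * n * p ^ b))"

lemma (in group) codegree_exponents_in_cod:
  assumes fin: "finite (carrier G)" and cod: "cod G \<subseteq> (\<lambda>b. of_nat (p ^ b)) ` S"
  shows "codegree_exponents_in G p S"
  unfolding codegree_exponents_in_def
proof (intro allI impI)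
  fix n \<rho> assume irr: "irr_rep G n \<rho>"
  interpret finite_irr_rep G n \<rho> by (rule finite_irr_repI[OF fin irr])
  define \<chi> where "\<chi> = (\<lambda>g. if g \<in> carrier G then mat_trace (\<rho> g) else 0)"
  have "\<chi> \<in> Irr G" using irr by (auto simp: Irr_def \<chi>_def)
  hence "codegree G \<chi> \<in> (\<lambda>b. of_nat (p ^ b)) ` S" using cod by (auto simp: cod_def)
  then obtain b where b: "b \<in> S" "codegree G \<chi> = of_nat (p ^ b)" by auto
  have ker: "char_ker G \<chi> = rep_ker" unfolding rep_ker_eq_trace by (auto simp: char_ker_def \<chi>_def)
  have "card rep_ker > 0"
    using subgroup.one_closed[OF rep_ker_subgroup]
      finite_subset[OF subgroup.subset[OF rep_ker_subgroup] fin] card_gt_0_iff by blast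
  hence "(of_nat (card (carrier G)) :: complex) = of_nat (card rep_ker * n * p ^ b)"
    using b(2) dim_pos unfolding codegree_def ker by (simp add: \<chi>_def field_simps)
  hence "card (carrier G) = card rep_ker * n * p ^ b" by (simp only: of_nat_eq_iff)
  thus "\<exists>b\<in>S. card (carrier G) = card {g \<in> carrier G. \<rho> g = 1\<^sub>m n} * n * p ^ b"
    using b(1) by (auto simp: rep_ker_def)
qed

text \<open>Inflation multiplies the group order and the kernel order by |N| and keeps the degree,
  so the codegree is unchanged.\<close>

lemma (in group) codegree_exponents_in_FactGroup:
  assumes fin: "finite (carrier G)" and N: "N \<lhd> G" and S: "codegree_exponents_in G p S"
  shows "codegree_exponents_in (G Mod N) p S"
  unfolding codegree_exponents_in_def
proof (intro allI impI)
  fix n \<sigma> assume irr: "irr_rep (G Mod N) n \<sigma>"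
  interpret h: group_hom G "G Mod N" "\<lambda>x. N #> x" by (rule FactGroup_hom[OF N])
  have irrG: "irr_rep G n (\<sigma> \<circ> (\<lambda>x. N #> x))"
    using h.group_hom_axioms irr by (intro irr_rep_comp_hom) (auto simp: carrier_FactGroup)
  interpret r: finite_irr_rep G n "\<sigma> \<circ> (\<lambda>x. N #> x)" by (rule finite_irr_repI[OF fin irrG])
  obtain b where b: "b \<in> S" "card (carrier G) = card r.rep_ker * n * p ^ b"
    using S irrG unfolding codegree_exponents_in_def r.rep_ker_def by blast
  have Nc: "N \<subseteq> carrier G" by (rule subgroup.subset[OF normal_imp_subgroup[OF N]])
  have "(\<sigma> \<circ> (\<lambda>x. N #> x)) x = 1\<^sub>m n" if "x \<in> N" for x
  proof -
    have "N #> x = \<one>\<^bsub>G Mod N\<^esub>" using that coset_eq_self_iff[OF N, of x] Nc by auto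
    thus ?thesis using irr by (simp add: irr_rep_def is_rep_def)
  qed
  hence NK: "N \<subseteq> r.rep_ker" using Nc by (auto simp: r.rep_ker_def)
  have kerc: "r.rep_ker \<subseteq> carrier G" by (rule subgroup.subset[OF r.rep_ker_subgroup])
  have "card r.rep_ker = card N * card ((\<lambda>x. N #> x) ` r.rep_ker)"
  proof (rule card_eq_kernel_times_image[OF finite_subset[OF kerc fin] r.rep_ker_subgroup NK])
    fix x y assume "x \<in> r.rep_ker" "y \<in> r.rep_ker"
    thus "N #> x = N #> y \<longleftrightarrow> x \<otimes> inv y \<in> N" using kerc by (intro coset_eq_iff[OF N]) auto
  qed
  also have "(\<lambda>x. N #> x) ` r.rep_ker = {g \<in> carrier (G Mod N). \<sigma> g = 1\<^sub>m n}"
    by (auto simp: r.rep_ker_def carrier_FactGroup)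
  finally have ker: "card r.rep_ker = card N * card {g \<in> carrier (G Mod N). \<sigma> g = 1\<^sub>m n}" .
  have "card (carrier G) = card N * card (carrier (G Mod N))"
    using lagrange[OF normal_imp_subgroup[OF N]] by (simp add: FactGroup_def order_def mult.commute)
  moreover have "card N > 0"
    using subgroup.one_closed[OF normal_imp_subgroup[OF N]] finite_subset[OF Nc fin] card_gt_0_iff by blast
  ultimately have "card (carrier (G Mod N)) = card {g \<in> carrier (G Mod N). \<sigma> g = 1\<^sub>m n} * n * p ^ b"
    using b(2) ker by (simp add: mult.assoc)
  thus "\<exists>b\<in>S. card (carrier (G Mod N)) = card {g \<in> carrier (G Mod N). \<sigma> g = 1\<^sub>m n} * n * p ^ b"
    using b(1) by blast
qed

section \<open>Exponents and orders in the lower central series\<close>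

context p_group
begin

lemma pow_mem_of_index_le:
  assumes N: "N \<lhd> G" and card: "card (carrier G) = card N * p ^ b" and b: "b \<le> 1" and g: "g \<in> carrier G"
  shows "g [^] p \<in> N"
proof -
  interpret h: group_hom G "G Mod N" "\<lambda>x. N #> x" by (rule FactGroup_hom[OF N])
  have "card (carrier G) = card N * card (carrier (G Mod N))"
    using lagrange[OF normal_imp_subgroup[OF N]] by (simp add: FactGroup_def order_def mult.commute)
  moreover have "card (carrier G) > 0" using p_group_finite one_closed card_gt_0_iff by blast
  ultimately have "card (carrier (G Mod N)) = p ^ b" using card by simp
  hence o: "order (G Mod N) = p ^ b" by (simp add: order_def)
  have "(N #> g) [^]\<^bsub>G Mod N\<^esub> p = \<one>\<^bsub>G Mod N\<^esub>"
  proof (cases "b = 0")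
    case True
    hence "carrier (G Mod N) = {\<one>\<^bsub>G Mod N\<^esub>}" using h.H.order_one_triv_iff o by simp
    hence "N #> g = \<one>\<^bsub>G Mod N\<^esub>" using h.hom_closed[OF g] by blast
    thus ?thesis by (metis h.H.nat_pow_one)
  next
    case False
    thus ?thesis using h.H.pow_order_eq_1[OF h.hom_closed[OF g]] o b by (simp add: le_Suc_eq)
  qed
  thus ?thesis using coset_eq_self_iff[OF N, of "g [^] p"] g by (simp add: h.hom_nat_pow[symmetric])
qed

text \<open>Otherwise some linear character has order divisible by \<open>p\<^sup>2\<close>, and a power of it has
  order exactly \<open>p\<^sup>2\<close>, hence codegree \<open>p\<^sup>2\<close>.\<close>

lemma abelianization_exponent:
  assumes S: "codegree_exponents_in G p S" "2 \<notin> S" and x: "x \<in> carrier G"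
  shows "x [^] p \<in> lower_central G 1"
proof (rule ccontr)
  assume nx: "x [^] p \<notin> lower_central G 1"
  have "x [^] p \<in> central_mod (lower_central G 1)"
    using lower_central_subset_central_mod[of 0] x by auto
  then obtain n \<rho> where irr: "irr_rep G n \<rho>" and L: "\<forall>y\<in>lower_central G 1. \<rho> y = 1\<^sub>m n"
    and nt: "\<rho> (x [^] p) \<noteq> 1\<^sub>m n"
    using exists_irr_rep_mod[OF p_group_finite lower_central_normal _ nx] by blast
  interpret r: finite_irr_rep G n \<rho> by (rule finite_irr_repI[OF p_group_finite irr])
  have LK: "lower_central G 1 \<subseteq> r.rep_ker" using L lower_central_closed[of _ 1] by (auto simp: r.rep_ker_def)
  have comm: "commutator g h \<in> r.rep_ker" if "g \<in> carrier G" "h \<in> carrier G" for g h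
    using LK lower_central_SucI[of g 0 h] that by auto
  \<comment> \<open>All commutators act trivially, so \<rho> is scalar everywhere and
    \<open>r.scalar\<close> is a linear character of G.\<close>
  have Z: "r.rep_center = carrier G"
  proof
    show "carrier G \<subseteq> r.rep_center"
    proof
      fix g assume g: "g \<in> carrier G"
      thus "g \<in> r.rep_center"
        using r.commutator_in_rep_ker_iff comm unfolding commutator_def by (intro r.rep_centerI) auto
    qed
  qed (rule r.rep_center_carrier)
  let ?l = r.scalar
  have lpow: "?l (g [^] (k::nat)) = ?l g ^ k" if "g \<in> carrier G" for g k
    using r.scalar_pow(1) that Z by simp
  have lmult: "?l (g \<otimes> h) = ?l g * ?l h" if "g \<in> carrier G" "h \<in> carrier G" for g h
    using r.scalar_mult that Z by simp
  have l1: "?l \<one> = 1" using r.dim_pos by (simp add: r.scalar_def)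
  \<comment> \<open>The order of this linear character is p^j; since its value at x^p is not 1, j is
    at least 2.\<close>
  define j where "j = (LEAST j. \<forall>g\<in>carrier G. ?l g ^ (p ^ j) = 1)"
  obtain k where k: "card (carrier G) = p ^ k" using card_pow by blast
  have "\<forall>g\<in>carrier G. ?l g ^ (p ^ k) = 1"
    using lpow[of _ "order G"] pow_order_eq_1 l1 k by (simp add: order_def)
  hence j: "\<forall>g\<in>carrier G. ?l g ^ (p ^ j) = 1" unfolding j_def by (rule LeastI)
  have lx: "?l x ^ p \<noteq> 1"
    using r.scalar_eq_one_iff[of "x [^] p"] nt Z x lpow by (simp add: r.rep_ker_def)
  have j2: "j \<ge> 2"
  proof (rule ccontr)
    assume "\<not> j \<ge> 2"
    hence "j = 0 \<or> j = 1" by auto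
    hence "?l x = 1 \<or> ?l x ^ p = 1" using bspec[OF j x] by auto
    thus False using lx by auto
  qed
  hence "\<not> (\<forall>g\<in>carrier G. ?l g ^ (p ^ (j - 1)) = 1)"
    using not_less_Least[of "j - 1" "\<lambda>j. \<forall>g\<in>carrier G. ?l g ^ (p ^ j) = 1"] unfolding j_def by simp
  then obtain y where y: "y \<in> carrier G" "?l y ^ (p ^ (j - 1)) \<noteq> 1" by blast
  \<comment> \<open>The q-th power of the linear character has order exactly p^2, witnessed at
    y.\<close>
  define q where "q = p ^ (j - 2)"
  obtain m where "j = m + 2" using j2 by (metis add.commute le_Suc_ex)
  hence q1: "q * p = p ^ (j - 1)" and q2: "q * p ^ 2 = p ^ j"
    unfolding q_def by (simp_all add: power_add power2_eq_square)
  define \<sigma> where "\<sigma> g = (?l g ^ q) \<cdot>\<^sub>m (1\<^sub>m 1 :: complex mat)" for g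
  have "is_rep G 1 \<sigma>"
    unfolding is_rep_def \<sigma>_def
    by (auto simp: lmult l1 power_mult_distrib scalar_prod_def intro!: eq_matI)
  hence irr1: "irr_rep G 1 \<sigma>" by (rule irr_rep_dim_one)
  interpret s: finite_irr_rep G 1 \<sigma> by (rule finite_irr_repI[OF p_group_finite irr1])
  obtain b where b: "b \<in> S" "card (carrier G) = card s.rep_ker * p ^ b"
    using S irr1 unfolding codegree_exponents_in_def s.rep_ker_def by fastforce
  have sZ: "s.rep_center = carrier G" unfolding s.rep_center_def \<sigma>_def by auto
  have ssc: "s.scalar g = ?l g ^ q" for g unfolding s.scalar_def \<sigma>_def by simp
  have "s.rep_ker \<subseteq> carrier G" unfolding s.rep_ker_def by auto
  hence "card (carrier G) = card s.rep_ker * card (s.scalar ` carrier G)"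
    using s.card_eq_card_ker_times_scalars[OF subgroup_self] sZ by (simp add: Int_absorb1)
  moreover have "card (carrier G) > 0" using p_group_finite one_closed card_gt_0_iff by blast
  ultimately have "p ^ b = card (s.scalar ` carrier G)" using b by simp
  also have "\<dots> \<le> p ^ 2"
  proof (rule card_roots_of_unity_le)
    fix t assume "t \<in> s.scalar ` carrier G"
    thus "t ^ p ^ 2 = 1" using j q2 by (auto simp: ssc simp flip: power_mult)
  qed (use p_gt_1 in simp)
  \<comment> \<open>The exponent 2 is excluded, so the kernel would have index at most p and y^p
    would act trivially; yet its value is that of y raised to p^(j-1).\<close>
  finally have "b \<le> 2" using p_gt_1 by simp
  hence "b \<le> 1" using b S by (cases "b = 2") auto
  hence "y [^] p \<in> s.rep_ker" by (rule pow_mem_of_index_le[OF s.rep_ker_normal b(2) _ y(1)])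
  hence "s.scalar y ^ p = 1"
    using s.scalar_eq_one_iff[of "y [^] p"] s.scalar_pow(1)[of y p] sZ y by simp
  thus False using y q1 by (simp add: ssc flip: power_mult)
qed

lemma lower_central_exponent:
  assumes S: "codegree_exponents_in G p S" "2 \<notin> S" and x: "x \<in> lower_central G i"
  shows "x [^] p \<in> lower_central G (Suc i)"
  using x
proof (induction i arbitrary: x)
  case 0 thus ?case using abelianization_exponent[OF S] by simp
next
  case (Suc i)
  show ?case by (rule lower_central_exponent_step[OF Suc.IH Suc.prems])
qed

text \<open>Every strict step multiplies the order by at least p. Term a is itself nontrivial, which
  accounts for the + 1 in the exponent.\<close>

lemma card_lower_central_ge:
  assumes ne: "lower_central G a \<noteq> {\<one>}" and i: "i \<le> a"
  shows "p ^ (a - i + 1) \<le> card (lower_central G i)" "lower_central G i \<noteq> {\<one>}"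
proof -
  have nei: "lower_central G j \<noteq> {\<one>}" if "j \<le> a" for j
    using ne lower_central_antimono[OF that] subgroup.one_closed[OF lower_central_subgroup[of a]] by auto
  show "lower_central G i \<noteq> {\<one>}" by (rule nei[OF i])
  have "p ^ (k + 1) \<le> card (lower_central G (a - k))" if "k \<le> a" for k
    using that
  proof (induction k)
    case 0
    have "card (lower_central G (Suc a)) > 0"
      using subgroup.one_closed[OF lower_central_subgroup] card_gt_0_iff
        finite_subset[OF subgroup.subset[OF lower_central_subgroup] p_group_finite] by blast
    hence "p * 1 \<le> p * card (lower_central G (Suc a))" by (intro mult_le_mono2) linarith
    also have "\<dots> \<le> card (lower_central G a)" by (rule card_lower_central_Suc[OF ne])
    finally show ?case by simp
  next
    case (Suc k)
    have "p ^ (Suc k + 1) = p * p ^ (k + 1)" by simp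
    also have "\<dots> \<le> p * card (lower_central G (a - k))" using Suc by (intro mult_le_mono2) simp
    also have "a - k = Suc (a - Suc k)" using Suc.prems by simp
    also have "p * card (lower_central G (Suc (a - Suc k))) \<le> card (lower_central G (a - Suc k))"
      by (intro card_lower_central_Suc nei) simp
    finally show ?case .
  qed
  from this[of "a - i"] i show "p ^ (a - i + 1) \<le> card (lower_central G i)" by simp
qed

section \<open>The bound on the class\<close>

lemma lower_central_trivial_of_small_order:
  assumes a: "a \<ge> 4" and S: "codegree_exponents_in G p {0, 1, a - 1, a}"
    and small: "p * card (carrier G) \<le> p ^ (2 * a)"
  shows "lower_central G a = {\<one>}"
proof (rule ccontr)
  \<comment> \<open>The index is one below the usual one: \<open>?L 1\<close> is the derived
    subgroup gamma_2, \<open>?L 2\<close> is gamma_3, \<open>?L 3\<close> is gamma_4, and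
    \<open>?L a\<close> is gamma_(a+1).\<close>
  let ?L = "lower_central G"
  assume ne: "?L a \<noteq> {\<one>}"
  note LcardI = card_lower_central_ge(1)[OF ne]
  have ne_i: "?L i \<noteq> {\<one>}" if "i \<le> a" for i by (rule card_lower_central_ge(2)[OF ne that])
  \<comment> \<open>For a = 3 this would fail, since then a - 1 = 2.\<close>
  have S2: "2 \<notin> {0, 1, a - 1, a}" using a by auto
  note exp = lower_central_exponent[OF S S2]
  have exp0: "g [^] p \<in> ?L 1" if "g \<in> carrier G" for g using exp[of g 0] that by simp
  have exp1: "g [^] p \<in> ?L 2" if "g \<in> ?L 1" for g using exp[OF that] by (simp add: numeral_2_eq_2)
  have exp2: "g [^] p \<in> ?L 3" if "g \<in> ?L 2" for g using exp[OF that] by (simp add: numeral_3_eq_3 numeral_2_eq_2)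
  have strict12: "?L 2 \<subset> ?L 1" using lower_central_strict[OF ne_i[of 1]] a by (simp add: numeral_2_eq_2)
  have strict23: "?L 3 \<subset> ?L 2"
    using lower_central_strict[OF ne_i[of 2]] a by (simp add: numeral_3_eq_3 numeral_2_eq_2)
  have L1c: "?L 1 \<subseteq> central_mod (?L 2)"
    using lower_central_subset_central_mod[of 1] by (simp add: numeral_2_eq_2)
  have L2c: "?L 2 \<subseteq> central_mod (?L 3)"
    using lower_central_subset_central_mod[of 2] by (simp add: numeral_3_eq_3 numeral_2_eq_2)
  have finS: "finite H" if "subgroup H G" for H
    by (rule finite_subset[OF subgroup.subset[OF that] p_group_finite])
  obtain z where z: "z \<in> ?L 1" "z \<notin> ?L 2" using strict12 by blast
  obtain n \<rho> where irr: "irr_rep G n \<rho>" and L2: "\<forall>y\<in>?L 2. \<rho> y = 1\<^sub>m n" and nt: "\<rho> z \<noteq> 1\<^sub>m n"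
    using exists_irr_rep_mod[OF p_group_finite lower_central_normal _ z(2)] z(1) L1c by blast
  interpret r: finite_irr_rep G n \<rho> by (rule finite_irr_repI[OF p_group_finite irr])
  define K where "K = r.rep_ker"
  define Z where "Z = r.rep_center"
  have K: "subgroup K G" and Z: "subgroup Z G" and KZ: "K \<subseteq> Z"
    unfolding K_def Z_def by (rule r.rep_ker_subgroup r.rep_center_subgroup r.rep_ker_le_center)+
  have Kpos: "card K > 0" using subgroup.one_closed[OF K] finS[OF K] card_gt_0_iff by blast
  have L2K: "?L 2 \<subseteq> K" using L2 lower_central_closed[of _ 2] by (auto simp: K_def r.rep_ker_def)
  have zK: "z \<notin> K" using nt by (simp add: K_def r.rep_ker_def)
  have commK: "commutator g h \<in> K" if "g \<in> Z" "h \<in> carrier G" for g h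
    using r.commutator_in_rep_ker_iff[of g h] r.rep_center_commutes[of g h] that r.rep_center_carrier
    unfolding commutator_def K_def Z_def by blast
  \<comment> \<open>Commutators with elements of gamma_2 lie in gamma_3, which acts trivially. Hence
    G/Z is abelian, as the equality |Z| n^2 = |G| requires.\<close>
  have L1Z: "?L 1 \<subseteq> Z"
  proof
    fix l assume l: "l \<in> ?L 1"
    have lc: "l \<in> carrier G" using lower_central_closed[OF l] .
    have "commutator l h \<in> K" if "h \<in> carrier G" for h
      using l L1c L2K that by (auto simp: central_mod_def)
    thus "l \<in> Z" unfolding Z_def
      using lc r.commutator_in_rep_ker_iff[of l] unfolding commutator_def K_def
      by (intro r.rep_centerI) auto
  qed
  have "commutator g h \<in> Z" if "g \<in> carrier G" "h \<in> carrier G" for g h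
    using L1Z lower_central_SucI[of g 0 h] that by auto
  hence dimZ: "card Z * n\<^sup>2 = card (carrier G)"
    unfolding Z_def commutator_def using r.card_center_mult_dim_eq by (simp add: order_def)
  define T where "T = r.scalar ` Z"
  have ZT: "card Z = card K * card T"
    using r.card_eq_card_ker_times_scalars[OF Z] KZ unfolding T_def Z_def K_def by (simp add: Int_absorb1)
  have scK: "r.scalar g = 1" if "g \<in> K" for g
    using r.scalar_eq_one_iff[of g] that KZ by (auto simp: K_def Z_def)
  have scp: "r.scalar (g [^] p) = r.scalar g ^ p" if "g \<in> Z" for g
    using r.scalar_pow(1) that by (simp add: Z_def)
  \<comment> \<open>p-th powers of gamma_2 fall into gamma_3, inside K, so at most p scalars occur
    on gamma_2. Likewise p-th powers of G fall into gamma_2, so all scalars on Z are p^2-th roots of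
    unity.\<close>
  have sc1: "r.scalar g ^ p = 1" if "g \<in> ?L 1" for g
  proof -
    have "g \<in> Z" "g [^] p \<in> K" using that exp1[OF that] L1Z L2K by blast+
    thus ?thesis using scK scp by metis
  qed
  have Zc: "g \<in> carrier G" if "g \<in> Z" for g by (rule subgroup.mem_carrier[OF Z that])
  have sc2: "r.scalar g ^ p ^ 2 = 1" if "g \<in> Z" for g
    using sc1[OF exp0[OF Zc[OF that]]] scp[OF that] by (simp add: power2_eq_square power_mult)
  have L1K: "card (?L 1) \<le> p * card K"
  proof -
    have "card (?L 1) = card (?L 1 \<inter> K) * card (r.scalar ` ?L 1)"
      using r.card_eq_card_ker_times_scalars[OF lower_central_subgroup] L1Z by (simp add: K_def Z_def)
    also have "card (?L 1 \<inter> K) \<le> card K" by (intro card_mono finS[OF K]) auto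
    also have "card (r.scalar ` ?L 1) \<le> p"
      using sc1 p_gt_1 by (intro card_roots_of_unity_le) auto
    finally show ?thesis by (simp add: mult.commute)
  qed
  have T2: "card T \<le> p ^ 2"
    unfolding T_def using sc2 p_gt_1 by (intro card_roots_of_unity_le) auto
  obtain i j where ij: "card Z = p ^ i" "card K = p ^ j"
    using card_subgroup_pow[OF Z] card_subgroup_pow[OF K] by metis
  have "K \<noteq> Z" using zK z L1Z by auto
  hence "card K < card Z" using KZ by (intro psubset_card_mono finS[OF Z]) auto
  hence "j < i" using ij p_gt_1 by simp
  define s where "s = i - j"
  have s: "card T = p ^ s" "s \<ge> 1"
    using ZT ij \<open>j < i\<close> p_gt_1 by (auto simp: s_def power_diff)
  have s2: "s \<le> 2" using T2 s p_gt_1 by simp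
  obtain b where b: "b \<in> {0, 1, a - 1, a}" "card (carrier G) = card K * n * p ^ b"
    using S irr unfolding codegree_exponents_in_def K_def r.rep_ker_def by blast
  \<comment> \<open>Two expressions for |G| are compared: |Z| n^2 with |Z| = |K| p^s, and the
    codegree equation.\<close>
  have "card K * n * (n * p ^ s) = card K * n * p ^ b"
    using b(2) dimZ ZT s by (simp add: power2_eq_square algebra_simps)
  hence nb: "n * p ^ s = p ^ b" using Kpos r.dim_pos by simp
  \<comment> \<open>With b <= 1 the degree would be 1, so G = Z and gamma_2 would lie in K, against
    the choice of z.\<close>
  have ba: "b \<ge> a - 1"
  proof (rule ccontr)
    assume "\<not> b \<ge> a - 1"
    hence "b \<le> 1" using b by auto
    have "n * p ^ 1 \<le> n * p ^ s" using s p_gt_1 by (intro mult_le_mono2 power_increasing) auto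
    also have "\<dots> \<le> p ^ 1" unfolding nb using \<open>b \<le> 1\<close> p_gt_1 by (intro power_increasing) auto
    finally have "n = 1" using p_gt_1 r.dim_pos by simp
    hence "Z = carrier G" using dimZ subgroup.subset[OF Z] by (intro card_subset_eq p_group_finite) auto
    hence "?L (Suc 0) \<subseteq> K" using commK by (intro lower_central_Suc_least[OF K]) simp
    thus False using z zK by auto
  qed
  \<comment> \<open>This keeps the natural-number differences b - s and 2 * b - s from
    truncating.\<close>
  have sb: "s \<le> b" using ba s2 a by linarith
  have "n * p ^ s = p ^ (b - s) * p ^ s" using nb sb by (simp flip: power_add)
  hence n: "n = p ^ (b - s)" using p_gt_1 by simp
  have "p ^ (a + (2 * b - s)) = p ^ a * (n * p ^ b)"
    unfolding n using sb by (simp add: mult_2 flip: power_add)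
  \<comment> \<open>gamma_2 has order at least p^a, and K meets it in index at most p.\<close>
  also have "p ^ a \<le> p * card K" using LcardI[of 1] L1K a by simp
  also have "p * card K * (n * p ^ b) = p * card (carrier G)" using b(2) by (simp add: ac_simps)
  also have "\<dots> \<le> p ^ (2 * a)" by (rule small)
  finally have "a + (2 * b - s) \<le> 2 * a" using p_gt_1 by simp
  hence vals: "a = 4" "b = 3" "s = 2" using ba s2 sb a by linarith+
  \<comment> \<open>In the tight case n = p and |G| = |K| p^4, so the size bound gives |K| <= p^3.
    Since gamma_3 lies in K and has order at least p^3, the two coincide.\<close>
  have "p * card K * p ^ 4 = p * card (carrier G)"
    unfolding b(2) n vals by (simp add: eval_nat_numeral ac_simps)
  also have "\<dots> \<le> p ^ 4 * p ^ 4" using small vals by (simp flip: power_add)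
  finally have "p * card K * p ^ 4 \<le> p ^ 4 * p ^ 4" .
  hence pK: "p * card K \<le> p ^ 4" using p_gt_1 by (simp only: mult_le_cancel2) simp
  hence cK: "card K \<le> p ^ 3" using p_gt_1 by (simp add: power_numeral_reduce)
  have cL1: "card (?L 1) \<le> p ^ 4" by (rule order.trans[OF L1K pK])
  have cL2: "card (?L 2) \<ge> p ^ 3" using LcardI[of 2] vals by (simp add: numeral_3_eq_3 numeral_2_eq_2)
  have KL2: "K = ?L 2"
    using card_subset_eq[OF finS[OF K] L2K] cK cL2 card_mono[OF finS[OF K] L2K] by simp
  \<comment> \<open>If all scalars on Z were p-th roots of unity, there would be at most p of them,
    not p^2.\<close>
  obtain u where u: "u \<in> Z" "r.scalar u ^ p \<noteq> 1"
  proof (rule ccontr)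
    assume "\<not> thesis"
    hence "card T \<le> p" unfolding T_def using that p_gt_1 by (intro card_roots_of_unity_le) auto
    thus False using s vals p_gt_1 by (simp add: power2_eq_square)
  qed
  have uc: "u \<in> carrier G" by (rule Zc[OF u(1)])
  have up: "u [^] p \<in> ?L 1" by (rule exp0[OF uc])
  have up2: "u [^] p \<notin> ?L 2" using u scp[OF u(1)] scK[of "u [^] p"] unfolding KL2 by metis
  define M where "M = central_mod (?L 3)"
  have M: "subgroup M G"
    unfolding M_def by (rule normal_imp_subgroup[OF central_mod_normal[OF lower_central_normal]])
  have "commutator (u [^] p) g \<in> ?L 3" if g: "g \<in> carrier G" for g
  proof -
    have "commutator u g \<in> ?L 2" using commK[OF u(1) g] KL2 by simp
    thus ?thesis
      using commutator_pow_mem_iff[OF lower_central_normal uc g, of 3 p] exp2 L2c by blast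
  qed
  hence uM: "u [^] p \<in> M" using uc by (simp add: M_def central_mod_def)
  have ML1: "subgroup (M \<inter> ?L 1) G" by (rule subgroups_Inter_pair[OF M lower_central_subgroup])
  \<comment> \<open>The element u^p lies in M and gamma_2 but not in gamma_3, so this intersection
    has order at least p^4 and exhausts gamma_2. Then gamma_2 is central modulo gamma_4, which
    forces gamma_3 into gamma_4.\<close>
  have "?L 2 \<subset> M \<inter> ?L 1" using uM up up2 L2c strict12 unfolding M_def by blast
  hence "p * card (?L 2) \<le> card (M \<inter> ?L 1)" by (rule card_strict_subgroup[OF lower_central_subgroup ML1])
  moreover have "p * p ^ 3 \<le> p * card (?L 2)" using cL2 by (rule mult_le_mono2)
  moreover have "p * p ^ 3 = p ^ 4" by (simp add: power_numeral_reduce)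
  moreover have "card (M \<inter> ?L 1) \<le> card (?L 1)" by (intro card_mono finS lower_central_subgroup) auto
  ultimately have "card (M \<inter> ?L 1) = card (?L 1)" using cL1 by linarith
  hence "M \<inter> ?L 1 = ?L 1" by (intro card_subset_eq finS lower_central_subgroup) auto
  hence "?L 1 \<subseteq> M" by blast
  hence "?L (Suc 1) \<subseteq> ?L 3"
    by (intro lower_central_Suc_least lower_central_subgroup) (auto simp: M_def central_mod_def)
  thus False using strict23 by (auto simp: numeral_2_eq_2)
qed

lemma lower_central_trivial:
  assumes a: "a \<ge> 4" and S: "codegree_exponents_in G p {0, 1, a - 1, a}"
  shows "lower_central G a = {\<one>}"
proof (rule ccontr)
  assume "lower_central G a \<noteq> {\<one>}"
  then obtain z where z: "z \<in> lower_central G a" "z \<noteq> \<one>" "\<And>g. g \<in> carrier G \<Longrightarrow> z \<otimes> g = g \<otimes> z"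
    using normal_meets_center[OF lower_central_normal] by blast
  have zc: "z \<in> carrier G" using lower_central_closed[OF z(1)] .
  obtain n \<rho> where irr: "irr_rep G n \<rho>" and nt: "\<rho> z \<noteq> 1\<^sub>m n"
    using exists_irr_rep_nontrivial_on_central[OF p_group_finite zc z(2,3)] by blast
  interpret r: finite_irr_rep G n \<rho> by (rule finite_irr_repI[OF p_group_finite irr])
  define K where "K = r.rep_ker"
  have K: "K \<lhd> G" unfolding K_def by (rule r.rep_ker_normal)
  note KG = normal_imp_subgroup[OF K]
  obtain b where b: "b \<in> {0, 1, a - 1, a}" "card (carrier G) = card K * n * p ^ b"
    using S irr unfolding codegree_exponents_in_def K_def r.rep_ker_def by blast
  have zK: "z \<notin> K" using nt by (simp add: K_def r.rep_ker_def)
  have "\<rho> h * \<rho> z = \<rho> z * \<rho> h" if "h \<in> carrier G" for h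
    using z(3)[OF that] zc that by (simp flip: r.rho_mult)
  hence "z \<in> r.rep_center" by (intro r.rep_centerI zc)
  hence "K \<subset> r.rep_center" using zK r.rep_ker_le_center unfolding K_def by blast
  \<comment> \<open>The central z acts as a scalar other than 1, so K has index at least p in the
    center of the character. With the degree bound this yields p n <= p^b.\<close>
  hence "p * card K \<le> card r.rep_center" by (rule card_strict_subgroup[OF KG r.rep_center_subgroup])
  hence "p * card K * n\<^sup>2 \<le> card r.rep_center * n\<^sup>2" by (rule mult_le_mono1)
  also have "\<dots> \<le> card K * n * p ^ b" using r.card_center_mult_dim_le b(2) by (simp add: order_def)
  finally have "card K * n * (p * n) \<le> card K * n * p ^ b" by (simp add: power2_eq_square ac_simps)
  moreover have Kpos: "card K > 0"
    using subgroup.one_closed[OF KG] finite_subset[OF subgroup.subset[OF KG] p_group_finite] card_gt_0_iff by blast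
  ultimately have pn: "p * n \<le> p ^ b" using r.dim_pos by simp
  have "card (carrier G) = card K * card (carrier (G Mod K))"
    using lagrange[OF KG] by (simp add: FactGroup_def order_def mult.commute)
  hence "card (carrier (G Mod K)) = n * p ^ b" using b(2) Kpos by simp
  \<comment> \<open>Carrying the factor p on the left expresses |G/K| <= p^(2a-1) without a
    subtraction in the exponent.\<close>
  hence "p * card (carrier (G Mod K)) = p * n * p ^ b" by simp
  also have "\<dots> \<le> p ^ b * p ^ b" using pn by (rule mult_le_mono1)
  also have "\<dots> \<le> p ^ (2 * a)"
  proof -
    have "b \<le> a" using b(1) a by auto
    thus ?thesis unfolding power_add[symmetric] using p_gt_1 by (intro power_increasing) auto
  qed
  finally have small: "p * card (carrier (G Mod K)) \<le> p ^ (2 * a)" .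
  interpret h: group_hom G "G Mod K" "\<lambda>x. K #> x" by (rule FactGroup_hom[OF K])
  interpret Q: p_group "G Mod K" p by (rule FactGroup_p_group[OF K])
  have "lower_central (G Mod K) a = {\<one>\<^bsub>G Mod K\<^esub>}"
    by (rule Q.lower_central_trivial_of_small_order
        [OF a codegree_exponents_in_FactGroup[OF p_group_finite K S] small])
  \<comment> \<open>The quotient map carries term a onto term a; the latter is trivial, so z would
    lie in K.\<close>
  moreover have "K #> z \<in> lower_central (G Mod K) a"
    using h.lower_central_image[of a] z(1) by (simp add: carrier_FactGroup)
  ultimately have "K #> z = K" by simp
  thus False using coset_eq_self_iff[OF K zc] zK by simp
qed

end

theorem theorem1p5:
  fixes G :: "('a, 'b) monoid_scheme" and p a :: nat
  assumes "Factorial_Ring.prime p"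
    and "group G" and "finite (carrier G)"
    and "\<exists>k. card (carrier G) = p ^ k"
    and "a \<ge> 4"
    and "cod G = {1, of_nat p, of_nat (p ^ (a - 1)), of_nat (p ^ a)}"
  shows "nilpotency_class G \<le> a"
proof -
  interpret p_group G p using assms by (simp add: p_group_def p_group_axioms_def)
  have "codegree_exponents_in G p {0, 1, a - 1, a}"
    using assms(3,6) by (intro codegree_exponents_in_cod) auto
  hence "lower_central G a = {\<one>\<^bsub>G\<^esub>}" by (rule lower_central_trivial[OF assms(5)])
  thus ?thesis unfolding nilpotency_class_def by (rule Least_le)
qed

end
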